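(* For every $\varepsilon>0$ there exists a non-locally convex quasi-Banach space $X$ with separating dual whose Banach envelope is $(1+\varepsilon)$-isomorphic to $c_0$, i.e. there is a linear isomorphism $T$ from the Banach envelope of $X$ onto $c_0$ with $\|T\|\,\|T^{-1}\|\le 1+\varepsilon$.
   Context: A quasi-norm on a real or complex vector space $X$ is a function $\|\cdot\|:X\to[0,\infty)$ such that $\|x\|=0$ iff $x=0$; $\|\lambda x\|=|\lambda|\|x\|$ for all scalars $\lambda$; and $\|x+y\|\le\Delta(\|x\|+\|y\|)$ for some fixed $\Delta\ge1$ and all $x,y$. It induces the smallest linear topology for which the unit ball $B_X=\{x:\|x\|\le 1\}$ is a neighbourhood of $0$; a quasi-Banach space is a complete quasi-normed space. It is locally convex if it is linearly isomorphic to a Banach space (equivalently, its quasi-norm is equivalent to a norm). The dual $X^*$ (continuous linear functionals) is a Banach space under $\|x^*\|=\sup_{\|x\|\le1}|x^*(x)|$. $X$ has separating dual if for each nonzero $x\in X$ there is $x^*\in X^*$ with $x^*(x)\ne0$. Let $\delta:X\to X^{**}$, $\delta(x)(x^* )=x^*(x)$. The Banach envelope $\operatorname{co}X$ of $X$ is the closure of $\delta(X)$ in $X^{**}$ with the induced norm. *)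

theory Defs
  imports "HOL-Analysis.Analysis" "HOL-Library.Function_Algebras"
begin

text \<open>
  A space is a linear subspace \<open>vecs S\<close> of an ambient vector space \<open>'v\<close>, with scalar
  multiplication \<open>smul S\<close> and a (quasi-)norm \<open>qnorm S\<close>, of which only the values on \<open>vecs S\<close>
  matter. Carriers are explicit because the dual, bidual and envelope of a space depend on its
  quasi-norm. The scalar field \<open>'k\<close> is meant to be instantiated with \<open>real\<close> or \<open>complex\<close>.
\<close>

record ('k, 'v) qspace =
  vecs :: "'v set"
  smul :: "'k \<Rightarrow> 'v \<Rightarrow> 'v"
  qnorm :: "'v \<Rightarrow> real"

definition quasi_norm_const :: "('k::real_normed_field, 'v::ab_group_add) qspace \<Rightarrow> real \<Rightarrow> bool"
  where "quasi_norm_const S \<Delta> \<longleftrightarrow>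
    vector_space (smul S) \<and> module.subspace (smul S) (vecs S) \<and>
    (\<forall>x\<in>vecs S. 0 \<le> qnorm S x) \<and>
    (\<forall>x\<in>vecs S. qnorm S x = 0 \<longleftrightarrow> x = 0) \<and>
    (\<forall>c. \<forall>x\<in>vecs S. qnorm S (smul S c x) = norm c * qnorm S x) \<and>
    (\<forall>x\<in>vecs S. \<forall>y\<in>vecs S. qnorm S (x + y) \<le> \<Delta> * (qnorm S x + qnorm S y))"

definition quasi_normed_space :: "('k::real_normed_field, 'v::ab_group_add) qspace \<Rightarrow> bool"
  where "quasi_normed_space S \<longleftrightarrow> (\<exists>\<Delta>\<ge>1. quasi_norm_const S \<Delta>)"

definition normed_space :: "('k::real_normed_field, 'v::ab_group_add) qspace \<Rightarrow> bool"
  where "normed_space S \<longleftrightarrow> quasi_norm_const S 1"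

definition complete_qspace :: "('k, 'v::ab_group_add) qspace \<Rightarrow> bool"
  where "complete_qspace S \<longleftrightarrow>
    (\<forall>s. (\<forall>n::nat. s n \<in> vecs S) \<and>
         (\<forall>e>0. \<exists>M. \<forall>m\<ge>M. \<forall>n\<ge>M. qnorm S (s m - s n) < e) \<longrightarrow>
         (\<exists>l\<in>vecs S. (\<lambda>n. qnorm S (s n - l)) \<longlonglongrightarrow> 0))"

definition quasi_banach_space :: "('k::real_normed_field, 'v::ab_group_add) qspace \<Rightarrow> bool"
  where "quasi_banach_space S \<longleftrightarrow> quasi_normed_space S \<and> complete_qspace S"

definition banach_space :: "('k::real_normed_field, 'v::ab_group_add) qspace \<Rightarrow> bool"
  where "banach_space S \<longleftrightarrow> normed_space S \<and> complete_qspace S"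

text \<open>
  The topology of a quasi-norm. Open balls of a quasi-norm need not be open in it. The theorem
  \<open>qtopology_smallest_linear\<close> below identifies it as the smallest linear topology for which the
  unit ball is a neighbourhood of 0.
\<close>

definition qtopology :: "('k, 'v::ab_group_add) qspace \<Rightarrow> 'v topology"
  where "qtopology S = topology (\<lambda>U. U \<subseteq> vecs S \<and>
    (\<forall>x\<in>U. \<exists>e>0. \<forall>y\<in>vecs S. qnorm S (y - x) < e \<longrightarrow> y \<in> U))"

definition linear_on ::
  "('k, 'v::ab_group_add) qspace \<Rightarrow> ('k \<Rightarrow> 'w \<Rightarrow> 'w) \<Rightarrow> ('v \<Rightarrow> 'w::ab_group_add) \<Rightarrow> bool"
  where "linear_on S scl f \<longleftrightarrow>
    (\<forall>x\<in>vecs S. \<forall>y\<in>vecs S. f (x + y) = f x + f y) \<and>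
    (\<forall>c. \<forall>x\<in>vecs S. f (smul S c x) = scl c (f x))"

definition linear_isomorphism ::
  "('k, 'v::ab_group_add) qspace \<Rightarrow> ('k, 'w::ab_group_add) qspace \<Rightarrow> ('v \<Rightarrow> 'w) \<Rightarrow> bool"
  where "linear_isomorphism S S' T \<longleftrightarrow>
    linear_on S (smul S') T \<and> homeomorphic_map (qtopology S) (qtopology S') T"

text \<open>
  The Banach space ranges over subspaces of the ambient type of \<open>S\<close>. This is no restriction: by
  \<open>locally_convex_if_isomorphic\<close> below, an isomorphism with a Banach space over any type suffices.
\<close>

definition locally_convex :: "('k::real_normed_field, 'v::ab_group_add) qspace \<Rightarrow> bool"
  where "locally_convex S \<longleftrightarrow>
    (\<exists>(B :: ('k, 'v) qspace) T. banach_space B \<and> linear_isomorphism S B T)"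

text \<open>
  For a continuous linear map this is a supremum of a nonempty set that is bounded above; on other
  maps the value may be meaningless.
\<close>

definition op_norm :: "('k, 'v) qspace \<Rightarrow> ('w \<Rightarrow> real) \<Rightarrow> ('v \<Rightarrow> 'w) \<Rightarrow> real"
  where "op_norm S n f = (SUP x\<in>{x\<in>vecs S. qnorm S x \<le> 1}. n (f x))"

abbreviation (input) fun_scale :: "'k::times \<Rightarrow> ('i \<Rightarrow> 'k) \<Rightarrow> ('i \<Rightarrow> 'k)"
  where "fun_scale \<equiv> (\<lambda>c f i. c * f i)"

text \<open>Functionals on \<open>vecs S\<close> are represented by their extension by 0 to the ambient type.\<close>

definition dual :: "('k::real_normed_field, 'v::ab_group_add) qspace \<Rightarrow> ('k, 'v \<Rightarrow> 'k) qspace"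
  where "dual S =
    \<lparr> vecs = {f. linear_on S (*) f \<and> continuous_map (qtopology S) euclidean f \<and>
                (\<forall>x. x \<notin> vecs S \<longrightarrow> f x = 0)},
      smul = fun_scale,
      qnorm = op_norm S norm \<rparr>"

definition separating_dual :: "('k::real_normed_field, 'v::ab_group_add) qspace \<Rightarrow> bool"
  where "separating_dual S \<longleftrightarrow> (\<forall>x\<in>vecs S. x \<noteq> 0 \<longrightarrow> (\<exists>f\<in>vecs (dual S). f x \<noteq> 0))"

definition bidual_embedding ::
  "('k::real_normed_field, 'v::ab_group_add) qspace \<Rightarrow> 'v \<Rightarrow> ('v \<Rightarrow> 'k) \<Rightarrow> 'k"
  where "bidual_embedding S x = (\<lambda>f. if f \<in> vecs (dual S) then f x else 0)"

definition banach_envelope ::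
  "('k::real_normed_field, 'v::ab_group_add) qspace \<Rightarrow> ('k, ('v \<Rightarrow> 'k) \<Rightarrow> 'k) qspace"
  where "banach_envelope S = (dual (dual S))
    \<lparr> vecs := qtopology (dual (dual S)) closure_of (bidual_embedding S ` vecs S) \<rparr>"

definition c0 :: "('k::real_normed_field, nat \<Rightarrow> 'k) qspace"
  where "c0 = \<lparr> vecs = {x. x \<longlonglongrightarrow> 0}, smul = fun_scale, qnorm = (\<lambda>x. SUP n. norm (x n)) \<rparr>"

text \<open>An isomorphism \<open>T\<close> with \<open>\<parallel>T\<parallel> \<parallel>T\<^sup>-\<^sup>1\<parallel> \<le> C\<close>.\<close>

definition isomorphic_const ::
  "real \<Rightarrow> ('k, 'v::ab_group_add) qspace \<Rightarrow> ('k, 'w::ab_group_add) qspace \<Rightarrow> bool"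
  where "isomorphic_const C S S' \<longleftrightarrow>
    (\<exists>T. linear_isomorphism S S' T \<and>
         op_norm S (qnorm S') T * op_norm S' (qnorm S) (inv_into (vecs S) T) \<le> C)"


subsection \<open>The topology of a quasi-norm\<close>

lemma openin_qtopology:
  "openin (qtopology S) U \<longleftrightarrow> U \<subseteq> vecs S \<and>
    (\<forall>x\<in>U. \<exists>e>0. \<forall>y\<in>vecs S. qnorm S (y - x) < e \<longrightarrow> y \<in> U)"
proof -
  define P where "P U \<longleftrightarrow> U \<subseteq> vecs S \<and>
    (\<forall>x\<in>U. \<exists>e>0. \<forall>y\<in>vecs S. qnorm S (y - x) < e \<longrightarrow> y \<in> U)" for U
  have P_Int: "P (U \<inter> V)" if U: "P U" and V: "P V" for U V
    unfolding P_def
  proof (intro conjI ballI)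
    show "U \<inter> V \<subseteq> vecs S" using U by (auto simp: P_def)
    fix x assume x: "x \<in> U \<inter> V"
    obtain d where d: "d > 0" "\<forall>y\<in>vecs S. qnorm S (y - x) < d \<longrightarrow> y \<in> U"
      using U x unfolding P_def by blast
    obtain e where e: "e > 0" "\<forall>y\<in>vecs S. qnorm S (y - x) < e \<longrightarrow> y \<in> V"
      using V x unfolding P_def by blast
    show "\<exists>e>0. \<forall>y\<in>vecs S. qnorm S (y - x) < e \<longrightarrow> y \<in> U \<inter> V"
      using d e by (intro exI[of _ "min d e"]) simp
  qed
  have P_Union: "P (\<Union>K)" if K: "\<forall>U\<in>K. P U" for K
    unfolding P_def
  proof (intro conjI ballI)
    show "\<Union>K \<subseteq> vecs S" using K unfolding P_def by blast
    fix x assume "x \<in> \<Union>K"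
    then obtain U where U: "U \<in> K" "x \<in> U" by blast
    then obtain e where "e > 0" "\<forall>y\<in>vecs S. qnorm S (y - x) < e \<longrightarrow> y \<in> U"
      using K unfolding P_def by blast
    then show "\<exists>e>0. \<forall>y\<in>vecs S. qnorm S (y - x) < e \<longrightarrow> y \<in> \<Union>K" using U by blast
  qed
  have "istopology P" using P_Int P_Union unfolding istopology_def by blast
  moreover have "qtopology S = topology P" unfolding qtopology_def P_def ..
  ultimately have "openin (qtopology S) U \<longleftrightarrow> P U" by (simp add: topology_inverse')
  then show ?thesis unfolding P_def .
qed

lemma topspace_qtopology [simp]: "topspace (qtopology S) = vecs S"
proof -
  have "openin (qtopology S) (vecs S)"
    unfolding openin_qtopology using zero_less_one by blast
  then have "vecs S \<subseteq> topspace (qtopology S)" by (rule openin_subset)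
  moreover have "topspace (qtopology S) \<subseteq> vecs S"
    using openin_topspace[of "qtopology S"] unfolding openin_qtopology by (rule conjunct1)
  ultimately show ?thesis by simp
qed

lemma quasi_norm_constD:
  fixes S :: "('k::real_normed_field, 'v::ab_group_add) qspace"
  assumes "quasi_norm_const S \<Delta>"
  shows "vector_space (smul S)" "0 \<in> vecs S"
    "\<And>x y. x \<in> vecs S \<Longrightarrow> y \<in> vecs S \<Longrightarrow> x + y \<in> vecs S"
    "\<And>x y. x \<in> vecs S \<Longrightarrow> y \<in> vecs S \<Longrightarrow> x - y \<in> vecs S"
    "\<And>c x. x \<in> vecs S \<Longrightarrow> smul S c x \<in> vecs S"
    "\<And>x. x \<in> vecs S \<Longrightarrow> 0 \<le> qnorm S x"
    "\<And>x. x \<in> vecs S \<Longrightarrow> qnorm S x = 0 \<longleftrightarrow> x = 0"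
    "\<And>c x. x \<in> vecs S \<Longrightarrow> qnorm S (smul S c x) = norm c * qnorm S x"
    "\<And>x y. x \<in> vecs S \<Longrightarrow> y \<in> vecs S \<Longrightarrow> qnorm S (x + y) \<le> \<Delta> * (qnorm S x + qnorm S y)"
proof -
  show vs: "vector_space (smul S)" using assms by (simp add: quasi_norm_const_def)
  interpret vector_space "smul S" by (fact vs)
  have sub: "subspace (vecs S)" using assms by (simp add: quasi_norm_const_def)
  show "0 \<in> vecs S" "\<And>x y. x \<in> vecs S \<Longrightarrow> y \<in> vecs S \<Longrightarrow> x + y \<in> vecs S"
    "\<And>x y. x \<in> vecs S \<Longrightarrow> y \<in> vecs S \<Longrightarrow> x - y \<in> vecs S"
    "\<And>c x. x \<in> vecs S \<Longrightarrow> smul S c x \<in> vecs S"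
    using sub by (auto simp: subspace_0 subspace_add subspace_diff subspace_scale)
qed (use assms in \<open>auto simp: quasi_norm_const_def\<close>)

definition linear_topology :: "('k::real_normed_field, 'v::ab_group_add) qspace \<Rightarrow> 'v topology \<Rightarrow> bool"
  where "linear_topology S \<T> \<longleftrightarrow> topspace \<T> = vecs S \<and>
    continuous_map (prod_topology \<T> \<T>) \<T> (\<lambda>(x, y). x + y) \<and>
    continuous_map (prod_topology euclidean \<T>) \<T> (\<lambda>(c, x). smul S c x)"

definition unit_ball_nhd :: "('k, 'v::zero) qspace \<Rightarrow> 'v topology \<Rightarrow> bool"
  where "unit_ball_nhd S \<T> \<longleftrightarrow>
    (\<exists>U. openin \<T> U \<and> 0 \<in> U \<and> U \<subseteq> {x\<in>vecs S. qnorm S x \<le> 1})"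

lemma qtopology_nhd:
  fixes S :: "('k::real_normed_field, 'v::ab_group_add) qspace"
  assumes S: "quasi_norm_const S \<Delta>" and "\<Delta> \<ge> 1" and a: "a \<in> vecs S" and "e > 0"
  obtains U where "openin (qtopology S) U" "a \<in> U" "\<And>x. x \<in> U \<Longrightarrow> x \<in> vecs S \<and> qnorm S (x - a) < e"
proof
  note D = quasi_norm_constD[OF S]
  let ?U = "{x\<in>vecs S. \<exists>r>0. \<forall>y\<in>vecs S. qnorm S (y - x) < r \<longrightarrow> qnorm S (y - a) < e}"
  show "a \<in> ?U" using a \<open>e > 0\<close> by blast
  show "x \<in> vecs S \<and> qnorm S (x - a) < e" if "x \<in> ?U" for x
    using that D(2,7) by fastforce
  show "openin (qtopology S) ?U"
    unfolding openin_qtopology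
  proof (intro conjI ballI)
    fix x assume "x \<in> ?U"
    then obtain r where r: "x \<in> vecs S" "r > 0"
      "\<And>y. y \<in> vecs S \<Longrightarrow> qnorm S (y - x) < r \<Longrightarrow> qnorm S (y - a) < e" by blast
    define d where "d = r / (2 * \<Delta>)"
    have d: "d > 0" "\<Delta> * (d + d) = r" using r \<open>\<Delta> \<ge> 1\<close> by (auto simp: d_def field_simps)
    have "y \<in> ?U" if y: "y \<in> vecs S" "qnorm S (y - x) < d" for y
    proof -
      have "qnorm S (z - a) < e" if z: "z \<in> vecs S" "qnorm S (z - y) < d" for z
      proof (rule r(3)[OF z(1)])
        have "qnorm S ((z - y) + (y - x)) \<le> \<Delta> * (qnorm S (z - y) + qnorm S (y - x))"
          by (rule D(9)[OF D(4)[OF z(1) y(1)] D(4)[OF y(1) r(1)]])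
        also have "\<dots> < \<Delta> * (d + d)"
          using z y \<open>\<Delta> \<ge> 1\<close> by (intro mult_strict_left_mono) auto
        finally show "qnorm S (z - x) < r" using d by simp
      qed
      then show ?thesis using y d by blast
    qed
    then show "\<exists>d>0. \<forall>y\<in>vecs S. qnorm S (y - x) < d \<longrightarrow> y \<in> ?U" using d by blast
  qed auto
qed

theorem qtopology_smallest_linear:
  fixes S :: "('k::real_normed_field, 'v::ab_group_add) qspace"
  assumes "quasi_normed_space S"
  shows "linear_topology S (qtopology S)" "unit_ball_nhd S (qtopology S)"
    and "\<And>\<T> U. linear_topology S \<T> \<Longrightarrow> unit_ball_nhd S \<T> \<Longrightarrow> openin (qtopology S) U \<Longrightarrow> openin \<T> U"
proof -
  obtain \<Delta> where \<Delta>: "\<Delta> \<ge> 1" and S: "quasi_norm_const S \<Delta>"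
    using assms by (auto simp: quasi_normed_space_def)
  note D = quasi_norm_constD[OF S]
  interpret vector_space "smul S" by (fact D(1))
  show "unit_ball_nhd S (qtopology S)"
  proof -
    obtain U where "openin (qtopology S) U" "0 \<in> U" "\<And>x. x \<in> U \<Longrightarrow> x \<in> vecs S \<and> qnorm S (x - 0) < 1"
      using qtopology_nhd[OF S \<Delta> D(2), of 1] by auto
    then show ?thesis unfolding unit_ball_nhd_def by (intro exI[of _ U]) fastforce
  qed
  show "linear_topology S (qtopology S)"
    unfolding linear_topology_def
  proof (intro conjI)
    show "continuous_map (prod_topology (qtopology S) (qtopology S)) (qtopology S) (\<lambda>(x, y). x + y)"
      unfolding continuous_map_def
    proof (intro conjI allI impI)
      fix W assume W: "openin (qtopology S) W"
      have "\<exists>U V. openin (qtopology S) U \<and> openin (qtopology S) V \<and> x \<in> U \<and> y \<in> V \<and>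
          U \<times> V \<subseteq> {p \<in> vecs S \<times> vecs S. (case p of (x, y) \<Rightarrow> x + y) \<in> W}"
        if xy: "x \<in> vecs S" "y \<in> vecs S" "x + y \<in> W" for x y
      proof -
        obtain e where e: "e > 0" "\<And>z. z \<in> vecs S \<Longrightarrow> qnorm S (z - (x + y)) < e \<Longrightarrow> z \<in> W"
          using W xy(3) unfolding openin_qtopology by blast
        define d where "d = e / (2 * \<Delta>)"
        have d: "d > 0" "\<Delta> * (d + d) = e" using e \<Delta> by (auto simp: d_def field_simps)
        obtain U where U: "openin (qtopology S) U" "x \<in> U"
          "\<And>z. z \<in> U \<Longrightarrow> z \<in> vecs S \<and> qnorm S (z - x) < d"
          by (rule qtopology_nhd[OF S \<Delta> xy(1) d(1)]) blast
        obtain V where V: "openin (qtopology S) V" "y \<in> V"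
          "\<And>z. z \<in> V \<Longrightarrow> z \<in> vecs S \<and> qnorm S (z - y) < d"
          by (rule qtopology_nhd[OF S \<Delta> xy(2) d(1)]) blast
        have "u + v \<in> W" if uv: "u \<in> U" "v \<in> V" for u v
        proof (rule e(2))
          have m: "u \<in> vecs S" "v \<in> vecs S" using U(3)[OF uv(1)] V(3)[OF uv(2)] by simp_all
          show "u + v \<in> vecs S" by (rule D(3)[OF m])
          have "qnorm S ((u - x) + (v - y)) \<le> \<Delta> * (qnorm S (u - x) + qnorm S (v - y))"
            by (rule D(9)[OF D(4)[OF m(1) xy(1)] D(4)[OF m(2) xy(2)]])
          also have "\<dots> < \<Delta> * (d + d)"
            using U(3)[OF uv(1)] V(3)[OF uv(2)] \<Delta> by (intro mult_strict_left_mono) auto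
          finally show "qnorm S (u + v - (x + y)) < e" using d by (simp add: algebra_simps)
        qed
        then have "U \<times> V \<subseteq> {p \<in> vecs S \<times> vecs S. (case p of (x, y) \<Rightarrow> x + y) \<in> W}"
          using U(3) V(3) by auto
        with U(1,2) V(1,2) show ?thesis by blast
      qed
      then show "openin (prod_topology (qtopology S) (qtopology S))
          {p \<in> topspace (prod_topology (qtopology S) (qtopology S)). (case p of (x, y) \<Rightarrow> x + y) \<in> W}"
        unfolding openin_prod_topology_alt topspace_prod_topology topspace_qtopology by simp
    qed (use D(3) in auto)
    show "continuous_map (prod_topology euclidean (qtopology S)) (qtopology S) (\<lambda>(c, x). smul S c x)"
      unfolding continuous_map_def
    proof (intro conjI allI impI)
      fix W assume W: "openin (qtopology S) W"
      have "\<exists>U V. open U \<and> openin (qtopology S) V \<and> c \<in> U \<and> x \<in> V \<and>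
          U \<times> V \<subseteq> {p \<in> UNIV \<times> vecs S. (case p of (c, x) \<Rightarrow> smul S c x) \<in> W}"
        if cx: "x \<in> vecs S" "smul S c x \<in> W" for c x
      proof -
        obtain e where e: "e > 0" "\<And>z. z \<in> vecs S \<Longrightarrow> qnorm S (z - smul S c x) < e \<Longrightarrow> z \<in> W"
          using W cx(2) unfolding openin_qtopology by blast
        define d where "d = e / (2 * \<Delta>)"
        have d: "d > 0" "\<Delta> * (d + d) = e" using e \<Delta> by (auto simp: d_def field_simps)
        define r where "r = d / (norm c + 1)"
        define q where "q = min 1 (d / (qnorm S x + 1))"
        have nc: "norm c + 1 > 0" and nx: "qnorm S x + 1 > 0"
          using D(6)[OF cx(1)] norm_ge_zero[of c] by linarith+
        have r: "r > 0" "(norm c + 1) * r = d" using d nc by (auto simp: r_def)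
        have q: "q > 0" "q \<le> 1" using d nx by (simp_all add: q_def)
        have "q * (qnorm S x + 1) \<le> d / (qnorm S x + 1) * (qnorm S x + 1)"
          using nx by (intro mult_right_mono) (auto simp: q_def)
        then have qd: "q * (qnorm S x + 1) \<le> d" using nx by simp
        obtain V where V: "openin (qtopology S) V" "x \<in> V"
          "\<And>z. z \<in> V \<Longrightarrow> z \<in> vecs S \<and> qnorm S (z - x) < r"
          by (rule qtopology_nhd[OF S \<Delta> cx(1) r(1)]) blast
        have "smul S b y \<in> W" if bys: "b \<in> ball c q" "y \<in> V" for b y
        proof (rule e(2))
          have y: "y \<in> vecs S" "y - x \<in> vecs S" "qnorm S (y - x) < r"
            using V(3)[OF bys(2)] D(4)[OF _ cx(1)] by simp_all
          show "smul S b y \<in> vecs S" by (rule D(5)[OF y(1)])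
          have bc: "norm (b - c) < q" using bys(1) by (simp add: dist_norm norm_minus_commute)
          have "norm b \<le> norm (b - c) + norm c" using norm_triangle_sub[of b c] by simp
          then have nb: "norm b \<le> norm c + 1" using bc q by linarith
          have "smul S b y - smul S c x = smul S b (y - x) + smul S (b - c) x"
            by (simp add: scale_right_diff_distrib scale_left_diff_distrib)
          then have "qnorm S (smul S b y - smul S c x)
            \<le> \<Delta> * (qnorm S (smul S b (y - x)) + qnorm S (smul S (b - c) x))"
            using D(9)[OF D(5)[OF y(2), of b] D(5)[OF cx(1), of "b - c"]] by simp
          also have "\<dots> = \<Delta> * (norm b * qnorm S (y - x) + norm (b - c) * qnorm S x)"
            using D(8) y cx by simp
          also have "\<dots> < \<Delta> * (d + d)"
          proof (intro mult_strict_left_mono add_less_le_mono)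
            have "norm b * qnorm S (y - x) \<le> (norm c + 1) * qnorm S (y - x)"
              using nb D(6)[OF y(2)] by (intro mult_right_mono) auto
            also have "\<dots> < (norm c + 1) * r" using y nc by (intro mult_strict_left_mono) auto
            finally show "norm b * qnorm S (y - x) < d" using r by simp
            have "norm (b - c) * qnorm S x \<le> q * (qnorm S x + 1)"
              using bc q D(6)[OF cx(1)] by (intro mult_mono) auto
            then show "norm (b - c) * qnorm S x \<le> d" using qd by simp
          qed (use \<Delta> in auto)
          finally show "qnorm S (smul S b y - smul S c x) < e" using d by simp
        qed
        then have "ball c q \<times> V \<subseteq> {p \<in> UNIV \<times> vecs S. (case p of (c, x) \<Rightarrow> smul S c x) \<in> W}"
          using V(3) by auto
        moreover have "open (ball c q)" "c \<in> ball c q" using q by auto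
        ultimately show ?thesis using V(1,2) by blast
      qed
      then show "openin (prod_topology euclidean (qtopology S))
          {p \<in> topspace (prod_topology euclidean (qtopology S)). (case p of (c, x) \<Rightarrow> smul S c x) \<in> W}"
        unfolding openin_prod_topology_alt topspace_prod_topology topspace_qtopology
        by (simp flip: open_openin)
    qed (use D(5) in auto)
  qed auto
  fix \<T> U assume \<T>: "linear_topology S \<T>" "unit_ball_nhd S \<T>" and U: "openin (qtopology S) U"
  obtain B where B: "openin \<T> B" "0 \<in> B" "\<And>x. x \<in> B \<Longrightarrow> x \<in> vecs S \<and> qnorm S x \<le> 1"
    using \<T>(2) unfolding unit_ball_nhd_def by blast
  show "openin \<T> U"
  proof (subst openin_subopen, intro ballI)
    fix x assume "x \<in> U"
    then obtain e where e: "e > 0" "\<And>y. y \<in> vecs S \<Longrightarrow> qnorm S (y - x) < e \<Longrightarrow> y \<in> U"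
      and x: "x \<in> vecs S"
      using U unfolding openin_qtopology by blast
    define c :: 'k where "c = of_real (2 / e)"
    have c: "c \<noteq> 0" "norm c = 2 / e" using e by (auto simp: c_def norm_divide)
    define g where "g = (\<lambda>y. smul S c (y - x))"
    have ts: "topspace \<T> = vecs S" using \<T> by (simp add: linear_topology_def)
    have "continuous_map \<T> (prod_topology \<T> \<T>) (\<lambda>y. (y, - x))"
      using D(4)[OF D(2) x] ts by (simp add: continuous_map_pairwise o_def)
    then have "continuous_map \<T> \<T> ((\<lambda>(x, y). x + y) \<circ> (\<lambda>y. (y, - x)))"
      using \<T> unfolding linear_topology_def by (blast intro: continuous_map_compose)
    then have "continuous_map \<T> (prod_topology euclidean \<T>) (\<lambda>y. (c, y - x))"
      by (simp add: continuous_map_pairwise o_def)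
    then have "continuous_map \<T> \<T> ((\<lambda>(c, x). smul S c x) \<circ> (\<lambda>y. (c, y - x)))"
      using \<T> unfolding linear_topology_def by (blast intro: continuous_map_compose)
    then have "continuous_map \<T> \<T> g" by (simp add: g_def o_def)
    then have "openin \<T> {y \<in> topspace \<T>. g y \<in> B}"
      using B by (simp add: openin_continuous_map_preimage)
    moreover have "x \<in> {y \<in> topspace \<T>. g y \<in> B}" using x ts B by (simp add: g_def)
    moreover have "{y \<in> topspace \<T>. g y \<in> B} \<subseteq> U"
    proof clarify
      fix y assume y: "y \<in> topspace \<T>" "g y \<in> B"
      then have "norm c * qnorm S (y - x) \<le> 1"
        using B(3)[of "g y"] D(8) D(4) x ts by (simp add: g_def)
      then have "qnorm S (y - x) \<le> e / 2" using e c by (simp add: field_simps)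
      then show "y \<in> U" using e y ts by auto
    qed
    ultimately show "\<exists>V. openin \<T> V \<and> x \<in> V \<and> V \<subseteq> U" by blast
  qed
qed


subsection \<open>Local convexity and equivalent norms\<close>

definition equivalent_norm ::
  "('k::real_normed_field, 'v::ab_group_add) qspace \<Rightarrow> ('v \<Rightarrow> real) \<Rightarrow> bool"
  where "equivalent_norm S n \<longleftrightarrow> normed_space (S\<lparr>qnorm := n\<rparr>) \<and>
    (\<exists>a>0. \<exists>b>0. \<forall>x\<in>vecs S. a * n x \<le> qnorm S x \<and> qnorm S x \<le> b * n x)"

lemma linear_continuous_bounded:
  fixes S :: "('k::real_normed_field, 'v::ab_group_add) qspace"
    and S' :: "('k, 'w::ab_group_add) qspace"
  assumes S: "quasi_normed_space S" and S': "quasi_normed_space S'"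
    and lin: "linear_on S (smul S') T"
    and cont: "continuous_map (qtopology S) (qtopology S') T"
  obtains C where "C > 0" "\<And>x. x \<in> vecs S \<Longrightarrow> qnorm S' (T x) \<le> C * qnorm S x"
proof -
  obtain \<Delta> \<Delta>' where \<Delta>: "\<Delta> \<ge> 1" "quasi_norm_const S \<Delta>" and \<Delta>': "\<Delta>' \<ge> 1" "quasi_norm_const S' \<Delta>'"
    using S S' by (auto simp: quasi_normed_space_def)
  note D = quasi_norm_constD[OF \<Delta>(2)] and D' = quasi_norm_constD[OF \<Delta>'(2)]
  have T: "T x \<in> vecs S'" if "x \<in> vecs S" for x
    using cont that by (auto simp: continuous_map_def)
  interpret V: vector_space "smul S" by (fact D(1))
  interpret W: vector_space "smul S'" by (fact D'(1))
  have "T (smul S 0 0) = smul S' 0 (T 0)" using lin D(2) unfolding linear_on_def by blast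
  then have T0: "T 0 = 0" by simp
  obtain U where U: "openin (qtopology S') U" "0 \<in> U"
    "\<And>x. x \<in> U \<Longrightarrow> x \<in> vecs S' \<and> qnorm S' (x - 0) < 1"
    using qtopology_nhd[OF \<Delta>'(2,1) D'(2), of 1] by auto
  have "openin (qtopology S) {x \<in> vecs S. T x \<in> U}"
    using openin_continuous_map_preimage[OF cont U(1)] by simp
  moreover have "0 \<in> {x \<in> vecs S. T x \<in> U}" using T0 U D by simp
  ultimately obtain e where e: "e > 0" "\<And>y. y \<in> vecs S \<Longrightarrow> qnorm S y < e \<Longrightarrow> T y \<in> U"
    unfolding openin_qtopology by force
  have "qnorm S' (T x) \<le> (2 / e) * qnorm S x" if x: "x \<in> vecs S" for x
  proof (cases "x = 0")
    case True
    then show ?thesis using T0 D(7)[OF D(2)] D'(7)[OF D'(2)] by simp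
  next
    case False
    then have p: "qnorm S x > 0" using D(6,7)[OF x] by linarith
    define c :: 'k where "c = of_real (e / (2 * qnorm S x))"
    have c: "norm c = e / (2 * qnorm S x)" using e p by (simp only: c_def norm_of_real) auto
    have "qnorm S (smul S c x) = e / 2" using D(8) x c p by simp
    then have "T (smul S c x) \<in> U" using e D(5) x by simp
    then have "qnorm S' (T (smul S c x)) < 1" using U(3) by fastforce
    moreover have "T (smul S c x) = smul S' c (T x)" using lin x by (simp add: linear_on_def)
    ultimately have "norm c * qnorm S' (T x) < 1" using D'(8) T x by simp
    then show ?thesis using c e p by (simp add: field_simps)
  qed
  then show ?thesis using that[of "2 / e"] e by simp
qed

lemma equivalent_norm_if_isomorphic:
  fixes S :: "('k::real_normed_field, 'v::ab_group_add) qspace"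
    and B :: "('k, 'w::ab_group_add) qspace"
  assumes S: "quasi_normed_space S" and B: "normed_space B" and T: "linear_isomorphism S B T"
  shows "equivalent_norm S (\<lambda>x. qnorm B (T x))"
proof -
  have B': "quasi_normed_space B" using B by (auto simp: quasi_normed_space_def normed_space_def)
  note DB = quasi_norm_constD[OF B[unfolded normed_space_def]]
  obtain \<Delta> where S': "quasi_norm_const S \<Delta>" using S by (auto simp: quasi_normed_space_def)
  note D = quasi_norm_constD[OF S']
  interpret V: vector_space "smul S" by (fact D(1))
  interpret W: vector_space "smul B" by (fact DB(1))
  have lin: "linear_on S (smul B) T" and hom: "homeomorphic_map (qtopology S) (qtopology B) T"
    using T by (auto simp: linear_isomorphism_def)
  obtain R where R: "homeomorphic_maps (qtopology S) (qtopology B) T R"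
    using hom unfolding homeomorphic_map_maps by (elim exE)
  have cT: "continuous_map (qtopology S) (qtopology B) T"
    and cR: "continuous_map (qtopology B) (qtopology S) R"
    and RT: "\<And>x. x \<in> vecs S \<Longrightarrow> R (T x) = x" and TR: "\<And>y. y \<in> vecs B \<Longrightarrow> T (R y) = y"
    using R unfolding homeomorphic_maps_def topspace_qtopology by blast+
  have mT: "T x \<in> vecs B" if "x \<in> vecs S" for x
    using continuous_map_image_subset_topspace[OF cT] that unfolding topspace_qtopology by blast
  have mR: "R x \<in> vecs S" if "x \<in> vecs B" for x
    using continuous_map_image_subset_topspace[OF cR] that unfolding topspace_qtopology by blast
  have T_add: "T (x + y) = T x + T y" if "x \<in> vecs S" "y \<in> vecs S" for x y
    using lin that by (simp add: linear_on_def)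
  have T_scale: "T (smul S c x) = smul B c (T x)" if "x \<in> vecs S" for c x
    using lin that by (simp add: linear_on_def)
  have "linear_on B (smul S) R"
    unfolding linear_on_def
  proof (intro conjI allI ballI)
    fix x y assume xy: "x \<in> vecs B" "y \<in> vecs B"
    have "T (R x + R y) = x + y" using T_add[OF mR mR] TR xy by simp
    then show "R (x + y) = R x + R y" using RT[OF D(3)[OF mR mR]] xy by metis
  next
    fix c x assume x: "x \<in> vecs B"
    have "T (smul S c (R x)) = smul B c x" using T_scale[OF mR] TR x by simp
    then show "R (smul B c x) = smul S c (R x)" using RT[OF D(5)[OF mR]] x by metis
  qed
  then obtain b where b: "b > 0" "\<And>y. y \<in> vecs B \<Longrightarrow> qnorm S (R y) \<le> b * qnorm B y"
    using linear_continuous_bounded[OF B' S _ cR] by blast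
  obtain a where a: "a > 0" "\<And>x. x \<in> vecs S \<Longrightarrow> qnorm B (T x) \<le> a * qnorm S x"
    using linear_continuous_bounded[OF S B' lin cT] by blast
  have T0: "T 0 = 0" using T_scale[OF D(2), of 0] by simp
  have Tz: "T x = 0 \<longleftrightarrow> x = 0" if "x \<in> vecs S" for x
    using RT[OF that] RT[OF D(2)] T0 by auto
  let ?n = "\<lambda>x. qnorm B (T x)"
  have "quasi_norm_const (S\<lparr>qnorm := ?n\<rparr>) 1"
    unfolding quasi_norm_const_def
  proof (intro conjI allI ballI)
    show "vector_space (smul (S\<lparr>qnorm := ?n\<rparr>))"
      and "module.subspace (smul (S\<lparr>qnorm := ?n\<rparr>)) (vecs (S\<lparr>qnorm := ?n\<rparr>))"
      using S' by (simp_all add: quasi_norm_const_def)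
  next
    fix x assume "x \<in> vecs (S\<lparr>qnorm := ?n\<rparr>)"
    then have x: "x \<in> vecs S" by simp
    show "0 \<le> qnorm (S\<lparr>qnorm := ?n\<rparr>) x"
      using DB(6)[OF mT[OF x]] by simp
    show "qnorm (S\<lparr>qnorm := ?n\<rparr>) x = 0 \<longleftrightarrow> x = 0"
      using DB(7)[OF mT[OF x]] Tz[OF x] by simp
    show "qnorm (S\<lparr>qnorm := ?n\<rparr>) (smul (S\<lparr>qnorm := ?n\<rparr>) c x)
        = norm c * qnorm (S\<lparr>qnorm := ?n\<rparr>) x" for c
      using DB(8)[OF mT[OF x]] T_scale[OF x] by simp
    fix y assume "y \<in> vecs (S\<lparr>qnorm := ?n\<rparr>)"
    then have y: "y \<in> vecs S" by simp
    show "qnorm (S\<lparr>qnorm := ?n\<rparr>) (x + y)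
        \<le> 1 * (qnorm (S\<lparr>qnorm := ?n\<rparr>) x + qnorm (S\<lparr>qnorm := ?n\<rparr>) y)"
      using DB(9)[OF mT[OF x] mT[OF y]] T_add[OF x y] by simp
  qed
  moreover have "\<forall>x\<in>vecs S. (1 / a) * ?n x \<le> qnorm S x \<and> qnorm S x \<le> b * ?n x"
  proof
    fix x assume x: "x \<in> vecs S"
    have "(1 / a) * ?n x \<le> qnorm S x" using a(2)[OF x] a(1) by (simp add: divide_le_eq mult.commute)
    moreover have "qnorm S x \<le> b * ?n x" using b(2)[OF mT[OF x]] RT[OF x] by simp
    ultimately show "(1 / a) * ?n x \<le> qnorm S x \<and> qnorm S x \<le> b * ?n x" by blast
  qed
  moreover have "1 / a > 0" using a(1) by simp
  ultimately show ?thesis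
    unfolding equivalent_norm_def normed_space_def using b(1) by blast
qed

lemma locally_convex_if_equivalent_norm:
  fixes S :: "('k::real_normed_field, 'v::ab_group_add) qspace"
  assumes S: "quasi_banach_space S" and n: "equivalent_norm S n"
  shows "locally_convex S"
proof -
  let ?B = "S\<lparr>qnorm := n\<rparr>"
  obtain a b where a: "a > 0" and b: "b > 0"
    and ab: "\<And>x. x \<in> vecs S \<Longrightarrow> a * n x \<le> qnorm S x \<and> qnorm S x \<le> b * n x"
    using n unfolding equivalent_norm_def by blast
  have nB: "normed_space ?B" using n by (simp add: equivalent_norm_def)
  note D = quasi_norm_constD[OF nB[unfolded normed_space_def], simplified]
  have "complete_qspace ?B"
    unfolding complete_qspace_def
  proof (intro allI impI, elim conjE)
    fix s :: "nat \<Rightarrow> 'v"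
    assume s: "\<forall>i. s i \<in> vecs ?B"
      and cau: "\<forall>e>0. \<exists>M. \<forall>i\<ge>M. \<forall>j\<ge>M. qnorm ?B (s i - s j) < e"
    have "\<exists>M. \<forall>i\<ge>M. \<forall>j\<ge>M. qnorm S (s i - s j) < e" if e: "e > 0" for e
    proof -
      obtain M where M: "\<And>i j. i \<ge> M \<Longrightarrow> j \<ge> M \<Longrightarrow> n (s i - s j) < e / b"
        using cau[rule_format, OF divide_pos_pos[OF e b]] by auto
      have "qnorm S (s i - s j) < e" if "i \<ge> M" "j \<ge> M" for i j
      proof -
        have "qnorm S (s i - s j) \<le> b * n (s i - s j)" using ab D(4) s by simp
        also have "\<dots> < b * (e / b)" using M that b by (intro mult_strict_left_mono) auto
        finally show ?thesis using b by simp
      qed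
      then show ?thesis by blast
    qed
    then have "(\<forall>i. s i \<in> vecs S) \<and> (\<forall>e>0. \<exists>M. \<forall>i\<ge>M. \<forall>j\<ge>M. qnorm S (s i - s j) < e)"
      using s by simp
    moreover have "complete_qspace S" using S by (simp add: quasi_banach_space_def)
    ultimately obtain l where l: "l \<in> vecs S" "(\<lambda>i. qnorm S (s i - l)) \<longlonglongrightarrow> 0"
      unfolding complete_qspace_def by blast
    have "(\<lambda>i. n (s i - l)) \<longlonglongrightarrow> 0"
    proof (rule real_tendsto_sandwich)
      show "\<forall>\<^sub>F i in sequentially. 0 \<le> n (s i - l)" using D(4,6) s l by simp
      show "\<forall>\<^sub>F i in sequentially. n (s i - l) \<le> qnorm S (s i - l) / a"
        using D(4) ab s l a by (simp add: field_simps)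
      show "(\<lambda>i. qnorm S (s i - l) / a) \<longlonglongrightarrow> 0" using tendsto_divide[OF l(2) tendsto_const[of a]] a by simp
    qed auto
    then show "\<exists>l\<in>vecs ?B. (\<lambda>i. qnorm ?B (s i - l)) \<longlonglongrightarrow> 0" using l by auto
  qed
  then have "banach_space ?B" using nB by (simp add: banach_space_def)
  moreover have "linear_isomorphism S ?B (\<lambda>x. x)"
  proof -
    have "openin (qtopology S) U \<longleftrightarrow> openin (qtopology ?B) U" for U
    proof
      assume U: "openin (qtopology S) U"
      show "openin (qtopology ?B) U"
        unfolding openin_qtopology
      proof (intro conjI ballI)
        show "U \<subseteq> vecs ?B" using U by (simp add: openin_qtopology)
        fix x assume x: "x \<in> U"
        then obtain e where e: "e > 0" "\<And>y. y \<in> vecs S \<Longrightarrow> qnorm S (y - x) < e \<Longrightarrow> y \<in> U"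
          using U unfolding openin_qtopology by blast
        have "y \<in> U" if y: "y \<in> vecs S" "n (y - x) < e / b" for y
        proof (rule e(2)[OF y(1)])
          have "x \<in> vecs S" using x U by (auto simp: openin_qtopology)
          then have "qnorm S (y - x) \<le> b * n (y - x)" using ab D(4) y by blast
          also have "\<dots> < b * (e / b)" using y b by (intro mult_strict_left_mono) auto
          finally show "qnorm S (y - x) < e" using b by simp
        qed
        then show "\<exists>d>0. \<forall>y\<in>vecs ?B. qnorm ?B (y - x) < d \<longrightarrow> y \<in> U"
          using e b by (intro exI[of _ "e / b"]) simp
      qed
    next
      assume U: "openin (qtopology ?B) U"
      show "openin (qtopology S) U"
        unfolding openin_qtopology
      proof (intro conjI ballI)
        show "U \<subseteq> vecs S" using U by (simp add: openin_qtopology)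
        fix x assume x: "x \<in> U"
        then obtain e where e: "e > 0" "\<And>y. y \<in> vecs S \<Longrightarrow> n (y - x) < e \<Longrightarrow> y \<in> U"
          using U unfolding openin_qtopology by auto
        have "y \<in> U" if y: "y \<in> vecs S" "qnorm S (y - x) < a * e" for y
        proof (rule e(2)[OF y(1)])
          have "x \<in> vecs S" using x U by (auto simp: openin_qtopology)
          then have "a * n (y - x) \<le> qnorm S (y - x)" using ab D(4) y by blast
          then have "a * n (y - x) < a * e" using y by linarith
          then show "n (y - x) < e" using a by simp
        qed
        then show "\<exists>d>0. \<forall>y\<in>vecs S. qnorm S (y - x) < d \<longrightarrow> y \<in> U"
          using e a by (intro exI[of _ "a * e"]) simp
      qed
    qed
    then have "qtopology ?B = qtopology S" by (simp add: topology_eq)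
    then have "homeomorphic_map (qtopology S) (qtopology ?B) (\<lambda>x. x)"
      using homeomorphic_map_id[of "qtopology S" "qtopology ?B"] by (simp add: id_def)
    then show ?thesis by (simp add: linear_isomorphism_def linear_on_def)
  qed
  ultimately show ?thesis unfolding locally_convex_def by blast
qed

theorem locally_convex_if_isomorphic:
  fixes S :: "('k::real_normed_field, 'v::ab_group_add) qspace"
    and B :: "('k, 'w::ab_group_add) qspace"
  assumes S: "quasi_banach_space S" and B: "banach_space B" and T: "linear_isomorphism S B T"
  shows "locally_convex S"
proof (rule locally_convex_if_equivalent_norm[OF S equivalent_norm_if_isomorphic[OF _ _ T]])
  show "quasi_normed_space S" using S by (simp add: quasi_banach_space_def)
  show "normed_space B" using B by (simp add: banach_space_def)
qed

theorem locally_convex_iff_equivalent_norm: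
  fixes S :: "('k::real_normed_field, 'v::ab_group_add) qspace"
  assumes S: "quasi_banach_space S"
  shows "locally_convex S \<longleftrightarrow> (\<exists>n. equivalent_norm S n)"
proof
  assume "locally_convex S"
  then obtain B :: "('k, 'v) qspace" and T where B: "banach_space B" and T: "linear_isomorphism S B T"
    unfolding locally_convex_def by (elim exE conjE)
  have "equivalent_norm S (\<lambda>x. qnorm B (T x))"
  proof (rule equivalent_norm_if_isomorphic[OF _ _ T])
    show "quasi_normed_space S" using S by (simp add: quasi_banach_space_def)
    show "normed_space B" using B by (simp add: banach_space_def)
  qed
  then show "\<exists>n. equivalent_norm S n" by (rule exI[of "equivalent_norm S"])
next
  assume "\<exists>n. equivalent_norm S n"
  then obtain n where "equivalent_norm S n" by (elim exE)
  then show "locally_convex S" by (rule locally_convex_if_equivalent_norm[OF S])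
qed

end

theory Submission
  imports Defs
begin

text \<open>
  Let \<open>C = 1 + \<epsilon>\<close> and enumerate as \<open>W 0, W 1, \<dots>\<close> the periodic sets of natural numbers of density at
  most \<open>1 - 1 / C\<close>. Let \<open>\<phi> A\<close> be the least number of sets of the form \<open>{n. i \<notin> W n}\<close> that cover \<open>A\<close>.
  This submeasure is unbounded on finite sets, because the residues of any \<open>m\<close> points modulo a large
  period give a periodic set of small density that contains them. On the other hand, for a finite set
  \<open>F\<close> and \<open>i\<close> uniform over a common period of the \<open>W n\<close> with \<open>n \<in> F\<close>, the random set
  \<open>{n \<in> F. i \<notin> W n}\<close>, of submeasure at most 1, contains each point of \<open>F\<close> with probability at least
  \<open>1 / C\<close>.

  Let \<open>X\<close> be the closure of the finitely supported sequences in the quasi-norm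
  \<open>q x = sup t * \<phi> {n. t \<le> \<bar>x n\<bar>}\<close> over \<open>t > 0\<close>, which dominates the sup norm. Averaging over \<open>i\<close> puts every
  finitely supported \<open>x\<close> with sup norm at most 1 into \<open>C\<close> times the convex hull of the unit ball of
  \<open>X\<close>. So the norm that \<open>X\<close> inherits from its bidual lies between \<open>1\<close> and \<open>C\<close> times the sup norm, and
  the envelope is \<open>c\<^sub>0\<close> up to the constant \<open>C\<close>. A norm equivalent to \<open>q\<close> would be bounded on the
  indicators of finite sets \<open>F\<close>, whereas \<open>q\<close> takes the value \<open>\<phi> F\<close> there.
\<close>

section \<open>Duals and Banach envelopes\<close>

lemma vector_space_fun_scale: "vector_space (fun_scale :: 'k::field \<Rightarrow> ('i \<Rightarrow> 'k) \<Rightarrow> 'i \<Rightarrow> 'k)"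
  by unfold_locales (auto simp: algebra_simps fun_eq_iff)

lemma quasi_norm_constI:
  fixes S :: "('k::real_normed_field, 'v::ab_group_add) qspace"
  assumes "vector_space (smul S)" "0 \<in> vecs S"
    "\<And>x y. x \<in> vecs S \<Longrightarrow> y \<in> vecs S \<Longrightarrow> x + y \<in> vecs S"
    "\<And>c x. x \<in> vecs S \<Longrightarrow> smul S c x \<in> vecs S"
    "\<And>x. x \<in> vecs S \<Longrightarrow> 0 \<le> qnorm S x"
    "qnorm S 0 = 0"
    "\<And>x. x \<in> vecs S \<Longrightarrow> qnorm S x = 0 \<Longrightarrow> x = 0"
    "\<And>c x. x \<in> vecs S \<Longrightarrow> qnorm S (smul S c x) = norm c * qnorm S x"
    "\<And>x y. x \<in> vecs S \<Longrightarrow> y \<in> vecs S \<Longrightarrow> qnorm S (x + y) \<le> \<Delta> * (qnorm S x + qnorm S y)"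
  shows "quasi_norm_const S \<Delta>"
proof -
  interpret vector_space "smul S" by fact
  have "subspace (vecs S)" using assms(2-4) by (simp add: subspace_def)
  then show ?thesis using assms by (auto simp: quasi_norm_const_def)
qed

lemma quasi_normed_space_if_normed: "normed_space S \<Longrightarrow> quasi_normed_space S"
  by (auto simp: normed_space_def quasi_normed_space_def)

lemma linear_on_diff:
  assumes "linear_on S scl f" "x \<in> vecs S" "y \<in> vecs S" "x - y \<in> vecs S"
  shows "f (x - y) = f x - f y"
proof -
  have "f ((x - y) + y) = f (x - y) + f y" using assms unfolding linear_on_def by blast
  then show ?thesis by simp
qed

text \<open>Linearity turns the bound into a Lipschitz estimate for \<open>T y - T x\<close>.
  Together with \<open>linear_continuous_bounded\<close> this lets continuity be handled through
  inequalities.\<close>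

lemma bounded_linear_continuous_map:
  fixes S :: "('k::real_normed_field, 'v::ab_group_add) qspace"
    and S' :: "('k, 'w::ab_group_add) qspace"
  assumes S: "quasi_normed_space S" and lin: "linear_on S scl T"
    and T: "\<And>x. x \<in> vecs S \<Longrightarrow> T x \<in> vecs S'"
    and C: "\<And>x. x \<in> vecs S \<Longrightarrow> qnorm S' (T x) \<le> C * qnorm S x"
  shows "continuous_map (qtopology S) (qtopology S') T"
  unfolding continuous_map_def topspace_qtopology
proof (intro conjI allI impI)
  obtain \<Delta> where "quasi_norm_const S \<Delta>" using S by (auto simp: quasi_normed_space_def)
  note D = quasi_norm_constD[OF this]
  fix U assume U: "openin (qtopology S') U"
  show "openin (qtopology S) {x \<in> vecs S. T x \<in> U}"
    unfolding openin_qtopology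
  proof (intro conjI ballI)
    fix x assume x: "x \<in> {x \<in> vecs S. T x \<in> U}"
    then obtain e where e: "e > 0" "\<And>z. z \<in> vecs S' \<Longrightarrow> qnorm S' (z - T x) < e \<Longrightarrow> z \<in> U"
      using U unfolding openin_qtopology by blast
    \<comment> \<open>The denominator \<open>\<bar>C\<bar> + 1\<close> is positive and dominates
      \<open>C\<close> for every real \<open>C\<close>, including \<open>C = 0\<close>.\<close>
    have "T y \<in> U" if y: "y \<in> vecs S" "qnorm S (y - x) < e / (\<bar>C\<bar> + 1)" for y
    proof (rule e(2)[OF T[OF y(1)]])
      have yx: "y - x \<in> vecs S" using D(4) x y by simp
      have "T y - T x = T (y - x)" using linear_on_diff[OF lin y(1) _ yx] x by simp
      then have "qnorm S' (T y - T x) \<le> C * qnorm S (y - x)" using C[OF yx] by simp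
      also have "\<dots> \<le> (\<bar>C\<bar> + 1) * qnorm S (y - x)" using D(6)[OF yx] by (intro mult_right_mono) auto
      also have "\<dots> < e" using y(2) by (simp add: field_simps)
      finally show "qnorm S' (T y - T x) < e" .
    qed
    then show "\<exists>d>0. \<forall>y\<in>vecs S. qnorm S (y - x) < d \<longrightarrow> y \<in> {x \<in> vecs S. T x \<in> U}"
      using e(1) by (intro exI[of _ "e / (\<bar>C\<bar> + 1)"]) auto
  qed auto
qed (use T in auto)

text \<open>Balls of a quasi-norm need not be open, so closeness is extracted from an open set
  inside the ball, supplied by \<open>qtopology_nhd\<close>. The converse follows from the
  definition of the open sets.\<close>

lemma closure_of_qtopology:
  fixes S :: "('k::real_normed_field, 'v::ab_group_add) qspace"
  assumes "quasi_normed_space S" "A \<subseteq> vecs S"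
  shows "x \<in> qtopology S closure_of A \<longleftrightarrow> x \<in> vecs S \<and> (\<forall>e>0. \<exists>y\<in>A. qnorm S (y - x) < e)"
proof
  assume x: "x \<in> qtopology S closure_of A"
  then have xS: "x \<in> vecs S" using closure_of_subset_topspace[of "qtopology S" A] by auto
  obtain \<Delta> where \<Delta>: "\<Delta> \<ge> 1" "quasi_norm_const S \<Delta>"
    using assms by (auto simp: quasi_normed_space_def)
  have "\<exists>y\<in>A. qnorm S (y - x) < e" if "e > 0" for e
  proof -
    obtain U where "openin (qtopology S) U" "x \<in> U" "\<And>y. y \<in> U \<Longrightarrow> y \<in> vecs S \<and> qnorm S (y - x) < e"
      using qtopology_nhd[OF \<Delta>(2,1) xS \<open>e > 0\<close>] by blast
    then show ?thesis using x unfolding in_closure_of by blast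
  qed
  then show "x \<in> vecs S \<and> (\<forall>e>0. \<exists>y\<in>A. qnorm S (y - x) < e)" using xS by blast
next
  assume x: "x \<in> vecs S \<and> (\<forall>e>0. \<exists>y\<in>A. qnorm S (y - x) < e)"
  show "x \<in> qtopology S closure_of A"
    unfolding in_closure_of topspace_qtopology
  proof (intro conjI allI impI)
    fix U assume U: "x \<in> U \<and> openin (qtopology S) U"
    then obtain e where "e > 0" "\<And>y. y \<in> vecs S \<Longrightarrow> qnorm S (y - x) < e \<Longrightarrow> y \<in> U"
      unfolding openin_qtopology by blast
    then show "\<exists>y. y \<in> A \<and> y \<in> U" using x assms(2) by blast
  qed (use x in blast)
qed

text \<open>Presenting the field as a space makes functionals instances of linear maps between
  spaces, so that the results on bounded maps apply to them.\<close>

definition scalar_space :: "('k::real_normed_field, 'k) qspace"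
  where "scalar_space = \<lparr> vecs = UNIV, smul = (*), qnorm = norm \<rparr>"

lemma normed_space_scalar: "normed_space (scalar_space :: ('k::real_normed_field, 'k) qspace)"
  unfolding normed_space_def
proof (rule quasi_norm_constI)
  show "vector_space (smul (scalar_space :: ('k, 'k) qspace))"
    unfolding scalar_space_def by unfold_locales (auto simp: algebra_simps)
qed (auto simp: scalar_space_def norm_mult norm_triangle_ineq)

lemma qtopology_scalar: "qtopology (scalar_space :: ('k::real_normed_field, 'k) qspace) = euclidean"
  unfolding topology_eq openin_qtopology
  by (auto simp: scalar_space_def open_dist dist_norm simp flip: open_openin)

section \<open>Operator norms and dual spaces\<close>

lemma op_norm_le:
  fixes S :: "('k::real_normed_field, 'v::ab_group_add) qspace"
  assumes "quasi_normed_space S" "C \<ge> 0" "\<And>x. x \<in> vecs S \<Longrightarrow> n (f x) \<le> C * qnorm S x"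
  shows "op_norm S n f \<le> C"
  unfolding op_norm_def
proof (rule cSUP_least)
  obtain \<Delta> where "quasi_norm_const S \<Delta>" using assms by (auto simp: quasi_normed_space_def)
  note D = quasi_norm_constD[OF this]
  show "{x \<in> vecs S. qnorm S x \<le> 1} \<noteq> {}" using D(2) D(7)[OF D(2)] by auto
  fix x assume "x \<in> {x \<in> vecs S. qnorm S x \<le> 1}"
  then show "n (f x) \<le> C" using assms(3)[of x] mult_left_mono[OF _ assms(2), of "qnorm S x" 1] by auto
qed

text \<open>The bound by \<open>C\<close> serves to make the set under the supremum bounded above;
  its value does not enter the conclusion.\<close>

lemma op_norm_upper:
  assumes "x \<in> vecs S" "qnorm S x \<le> 1" "\<And>x. x \<in> vecs S \<Longrightarrow> n (f x) \<le> C * qnorm S x" "C \<ge> 0"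
  shows "n (f x) \<le> op_norm S n f"
  unfolding op_norm_def
proof (rule cSUP_upper)
  show "bdd_above ((\<lambda>x. n (f x)) ` {x \<in> vecs S. qnorm S x \<le> 1})"
  proof (rule bdd_aboveI2)
    fix x assume "x \<in> {x \<in> vecs S. qnorm S x \<le> 1}"
    then show "n (f x) \<le> C" using assms(3)[of x] mult_left_mono[OF _ assms(4), of "qnorm S x" 1] by auto
  qed
qed (use assms in auto)

text \<open>Continuity is traded for boundedness, via \<open>scalar_space\<close>. Later arguments
  about duals use this form and no longer mention the topology.\<close>

lemma mem_dual_iff:
  fixes S :: "('k::real_normed_field, 'v::ab_group_add) qspace"
  assumes S: "quasi_normed_space S"
  shows "f \<in> vecs (dual S) \<longleftrightarrow> linear_on S (*) f \<and>
    (\<exists>C\<ge>0. \<forall>x\<in>vecs S. norm (f x) \<le> C * qnorm S x) \<and> (\<forall>x. x \<notin> vecs S \<longrightarrow> f x = 0)"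
proof -
  have "continuous_map (qtopology S) euclidean f \<longleftrightarrow> (\<exists>C\<ge>0. \<forall>x\<in>vecs S. norm (f x) \<le> C * qnorm S x)"
    if lin: "linear_on S (*) f"
  proof
    assume "continuous_map (qtopology S) euclidean f"
    then have c: "continuous_map (qtopology S) (qtopology scalar_space) f" by (simp add: qtopology_scalar)
    have "linear_on S (smul scalar_space) f" using lin by (simp add: scalar_space_def)
    then obtain C where "C > 0" "\<And>x. x \<in> vecs S \<Longrightarrow> qnorm scalar_space (f x) \<le> C * qnorm S x"
      using linear_continuous_bounded[OF S quasi_normed_space_if_normed[OF normed_space_scalar] _ c] by blast
    then show "\<exists>C\<ge>0. \<forall>x\<in>vecs S. norm (f x) \<le> C * qnorm S x"
      by (intro exI[of _ C]) (simp add: scalar_space_def)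
  next
    assume "\<exists>C\<ge>0. \<forall>x\<in>vecs S. norm (f x) \<le> C * qnorm S x"
    then obtain C where "\<And>x. x \<in> vecs S \<Longrightarrow> qnorm scalar_space (f x) \<le> C * qnorm S x"
      by (auto simp: scalar_space_def)
    then show "continuous_map (qtopology S) euclidean f"
      using bounded_linear_continuous_map[OF S lin, of scalar_space C]
      by (simp add: qtopology_scalar) (simp add: scalar_space_def)
  qed
  then show ?thesis unfolding dual_def by auto
qed

lemma qnorm_dual_le:
  fixes S :: "('k::real_normed_field, 'v::ab_group_add) qspace"
  assumes "quasi_normed_space S" "C \<ge> 0" "\<And>x. x \<in> vecs S \<Longrightarrow> norm (f x) \<le> C * qnorm S x"
  shows "qnorm (dual S) f \<le> C"
  using op_norm_le[where n = norm, OF assms] by (simp add: dual_def)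

text \<open>The supremum controls \<open>f\<close> on the unit ball; scaling a nonzero
  \<open>x\<close> by \<open>1 / qnorm S x\<close> extends the estimate to all vectors.\<close>

lemma norm_dual_apply_le:
  fixes S :: "('k::real_normed_field, 'v::ab_group_add) qspace"
  assumes S: "quasi_normed_space S" and f: "f \<in> vecs (dual S)"
  shows "0 \<le> qnorm (dual S) f" "\<And>x. x \<in> vecs S \<Longrightarrow> norm (f x) \<le> qnorm (dual S) f * qnorm S x"
proof -
  obtain \<Delta> where S': "quasi_norm_const S \<Delta>" using S by (auto simp: quasi_normed_space_def)
  note D = quasi_norm_constD[OF S']
  obtain C where C: "C \<ge> 0" "\<And>x. x \<in> vecs S \<Longrightarrow> norm (f x) \<le> C * qnorm S x" and lin: "linear_on S (*) f"
    using f mem_dual_iff[OF S] by blast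
  have up: "norm (f x) \<le> qnorm (dual S) f" if "x \<in> vecs S" "qnorm S x \<le> 1" for x
    using op_norm_upper[where n = norm, OF that C(2,1)] by (simp add: dual_def)
  have "norm (f 0) \<le> qnorm (dual S) f" using up[OF D(2)] D(7)[OF D(2)] by simp
  then show "0 \<le> qnorm (dual S) f" by (rule order_trans[OF norm_ge_zero])
  fix x assume x: "x \<in> vecs S"
  show "norm (f x) \<le> qnorm (dual S) f * qnorm S x"
  proof (cases "x = 0")
    case True
    then show ?thesis using C(2)[OF x] D(7)[OF D(2)] by simp
  next
    case False
    then have p: "qnorm S x > 0" using D(6,7)[OF x] by linarith
    define c :: 'k where "c = of_real (1 / qnorm S x)"
    have c: "norm c = 1 / qnorm S x" using p by (simp only: c_def norm_of_real) auto
    have "norm (f (smul S c x)) \<le> qnorm (dual S) f" using up[OF D(5)[OF x]] D(8)[OF x] c p by simp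
    moreover have "f (smul S c x) = c * f x" using lin x by (simp add: linear_on_def)
    ultimately show ?thesis using c p by (simp add: norm_mult field_simps)
  qed
qed

text \<open>The triangle inequality is inherited from the scalars, so the dual is normed with
  constant 1 although \<open>S\<close> is only quasi-normed.\<close>

theorem normed_space_dual:
  fixes S :: "('k::real_normed_field, 'v::ab_group_add) qspace"
  assumes S: "quasi_normed_space S"
  shows "normed_space (dual S)"
  unfolding normed_space_def
proof (rule quasi_norm_constI)
  note I = mem_dual_iff[OF S] and N = norm_dual_apply_le[OF S]
  obtain \<Delta> where "quasi_norm_const S \<Delta>" using S by (auto simp: quasi_normed_space_def)
  note D = quasi_norm_constD[OF this]
  have sm: "smul (dual S) = fun_scale" by (simp add: dual_def)
  show "vector_space (smul (dual S))" unfolding sm by (rule vector_space_fun_scale)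
  show "0 \<in> vecs (dual S)" unfolding I by (auto simp: linear_on_def D(6) intro!: exI[of _ 0])
  show z: "qnorm (dual S) 0 = 0"
    using qnorm_dual_le[OF S, of 0 0] N(1)[OF \<open>0 \<in> vecs (dual S)\<close>] by auto
  have sc: "smul (dual S) c f \<in> vecs (dual S) \<and> qnorm (dual S) (smul (dual S) c f) \<le> norm c * qnorm (dual S) f"
    if f: "f \<in> vecs (dual S)" for c f
  proof -
    have b: "norm (fun_scale c f x) \<le> (norm c * qnorm (dual S) f) * qnorm S x" if "x \<in> vecs S" for x
      using mult_left_mono[OF N(2)[OF f that] norm_ge_zero[of c]] by (simp add: norm_mult mult.assoc)
    have p: "0 \<le> norm c * qnorm (dual S) f" using N(1)[OF f] by simp
    show ?thesis
      using f b p qnorm_dual_le[OF S p b] unfolding sm I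
      by (auto simp: linear_on_def algebra_simps)
  qed
  fix f assume f: "f \<in> vecs (dual S)"
  show "0 \<le> qnorm (dual S) f" by (rule N(1)[OF f])
  show "smul (dual S) c f \<in> vecs (dual S)" for c using sc[OF f] by blast
  \<comment> \<open>Off \<open>vecs S\<close> the functional is 0 by the convention for representing
    functionals, so equality holds on the whole ambient type.\<close>
  show "f = 0" if "qnorm (dual S) f = 0"
  proof
    fix x show "f x = 0 x" using N(2)[OF f, of x] that f unfolding I by (cases "x \<in> vecs S") auto
  qed
  show "qnorm (dual S) (smul (dual S) c f) = norm c * qnorm (dual S) f" for c
  proof (rule antisym)
    show "qnorm (dual S) (smul (dual S) c f) \<le> norm c * qnorm (dual S) f" using sc[OF f] by blast
    show "norm c * qnorm (dual S) f \<le> qnorm (dual S) (smul (dual S) c f)"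
    proof (cases "c = 0")
      case True
      then show ?thesis using N(1) sc[OF f, of c] by simp
    next
      case False
      \<comment> \<open>The reverse inequality is the forward one applied to the scalar
        \<open>1 / c\<close>.\<close>
      have "smul (dual S) (1 / c) (smul (dual S) c f) = f" using False by (simp add: sm)
      then have "qnorm (dual S) f \<le> norm (1 / c) * qnorm (dual S) (smul (dual S) c f)"
        using sc[of "smul (dual S) c f" "1 / c"] sc[OF f, of c] by simp
      then show ?thesis using False by (simp add: norm_divide field_simps)
    qed
  qed
  fix g assume g: "g \<in> vecs (dual S)"
  have b: "norm ((f + g) x) \<le> (qnorm (dual S) f + qnorm (dual S) g) * qnorm S x" if "x \<in> vecs S" for x
    using norm_triangle_ineq[of "f x" "g x"] N(2)[OF f that] N(2)[OF g that] by (simp add: algebra_simps)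
  have p: "0 \<le> qnorm (dual S) f + qnorm (dual S) g" using N(1)[OF f] N(1)[OF g] by simp
  show "f + g \<in> vecs (dual S)"
    using f g b p unfolding I by (auto simp: linear_on_def algebra_simps)
  show "qnorm (dual S) (f + g) \<le> 1 * (qnorm (dual S) f + qnorm (dual S) g)"
    unfolding mult_1 by (rule qnorm_dual_le[OF S p b])
qed

text \<open>An explicit two-sided inverse \<open>R\<close> with a bound suffices: its linearity is
  forced by that of \<open>T\<close>, and it agrees with \<open>inv_into\<close> on
  \<open>vecs S'\<close>.\<close>

lemma isomorphic_constI:
  fixes S :: "('k::real_normed_field, 'v::ab_group_add) qspace"
    and S' :: "('k, 'w::ab_group_add) qspace"
  assumes S: "quasi_normed_space S" and S': "quasi_normed_space S'" and "A \<ge> 0" "B \<ge> 0"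
    and T: "linear_on S (smul S') T" "\<And>x. x \<in> vecs S \<Longrightarrow> T x \<in> vecs S'"
      "\<And>x. x \<in> vecs S \<Longrightarrow> qnorm S' (T x) \<le> A * qnorm S x"
    and R: "\<And>y. y \<in> vecs S' \<Longrightarrow> R y \<in> vecs S" "\<And>y. y \<in> vecs S' \<Longrightarrow> qnorm S (R y) \<le> B * qnorm S' y"
    and RT: "\<And>x. x \<in> vecs S \<Longrightarrow> R (T x) = x" and TR: "\<And>y. y \<in> vecs S' \<Longrightarrow> T (R y) = y"
  shows "isomorphic_const (A * B) S S'"
proof -
  obtain \<Delta> where "quasi_norm_const S \<Delta>" using S by (auto simp: quasi_normed_space_def)
  note D = quasi_norm_constD[OF this]
  obtain \<Delta>' where "quasi_norm_const S' \<Delta>'" using S' by (auto simp: quasi_normed_space_def)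
  note D' = quasi_norm_constD[OF this]
  have linR: "linear_on S' (smul S) R"
    unfolding linear_on_def
  proof (intro conjI allI ballI)
    fix x y assume xy: "x \<in> vecs S'" "y \<in> vecs S'"
    have "T (R x + R y) = x + y" using T(1) R(1) TR xy by (simp add: linear_on_def)
    then show "R (x + y) = R x + R y" using RT[OF D(3)[OF R(1) R(1)]] xy by metis
  next
    fix c x assume x: "x \<in> vecs S'"
    have "T (smul S c (R x)) = smul S' c x" using T(1) R(1) TR x by (simp add: linear_on_def)
    then show "R (smul S' c x) = smul S c (R x)" using RT[OF D(5)[OF R(1)]] x by metis
  qed
  have "homeomorphic_maps (qtopology S) (qtopology S') T R"
    unfolding homeomorphic_maps_def
    using bounded_linear_continuous_map[OF S T] bounded_linear_continuous_map[OF S' linR R] RT TR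
    by simp
  then have iso: "linear_isomorphism S S' T"
    unfolding linear_isomorphism_def using T(1) homeomorphic_map_maps by blast
  have inj: "inj_on T (vecs S)" using RT by (metis inj_onI)
  have inv: "inv_into (vecs S) T y = R y" if "y \<in> vecs S'" for y
    using inv_into_f_eq[OF inj R(1)[OF that] TR[OF that]] .
  have b: "qnorm S (inv_into (vecs S) T y) \<le> B * qnorm S' y" if "y \<in> vecs S'" for y
    using inv[OF that] R(2)[OF that] by simp
  \<comment> \<open>Multiplying the two norm bounds needs the second operator norm to be
    nonnegative; the point 0 of the unit ball witnesses this.\<close>
  have "qnorm S (inv_into (vecs S) T 0) \<le> op_norm S' (qnorm S) (inv_into (vecs S) T)"
    using op_norm_upper[where n = "qnorm S", OF D'(2) _ b \<open>B \<ge> 0\<close>] D'(7)[OF D'(2)] by simp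
  then have "0 \<le> op_norm S' (qnorm S) (inv_into (vecs S) T)"
    using D(6)[OF R(1)[OF D'(2)]] inv[OF D'(2)] by simp
  then have "op_norm S (qnorm S') T * op_norm S' (qnorm S) (inv_into (vecs S) T) \<le> A * B"
    using op_norm_le[where n = "qnorm S'", OF S \<open>A \<ge> 0\<close> T(3)]
      op_norm_le[where n = "qnorm S", OF S' \<open>B \<ge> 0\<close> b] \<open>A \<ge> 0\<close> by (intro mult_mono) auto
  then show ?thesis using iso unfolding isomorphic_const_def by blast
qed

section \<open>The space \<open>c0\<close>\<close>

lemma c0_bounded:
  fixes x :: "nat \<Rightarrow> 'k::real_normed_field"
  assumes "x \<longlonglongrightarrow> 0"
  shows "bdd_above (range (\<lambda>n. norm (x n)))"
proof -
  obtain K where "\<And>n. norm (x n) \<le> K"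
    using convergent_imp_Bseq[of x] assms by (auto simp: convergent_def Bseq_def)
  then show ?thesis by (rule bdd_aboveI2)
qed

lemma norm_le_c0: "x \<in> vecs c0 \<Longrightarrow> norm (x n) \<le> qnorm c0 x"
  by (auto simp: c0_def intro!: cSUP_upper c0_bounded)

lemma c0_norm_le: "(\<And>n. norm (x n) \<le> r) \<Longrightarrow> qnorm c0 x \<le> r"
  by (auto simp: c0_def intro!: cSUP_least)

lemma normed_space_c0: "normed_space (c0 :: ('k::real_normed_field, nat \<Rightarrow> 'k) qspace)"
  unfolding normed_space_def
proof (rule quasi_norm_constI)
  let ?c = "c0 :: ('k, nat \<Rightarrow> 'k) qspace"
  show "vector_space (smul ?c)" by (simp add: c0_def vector_space_fun_scale)
  show z: "0 \<in> vecs ?c" by (simp add: c0_def zero_fun_def)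
  have nn: "0 \<le> qnorm c0 x" if "x \<in> vecs ?c" for x using norm_le_c0[OF that, of 0] norm_ge_zero order_trans by blast
  show "qnorm ?c 0 = 0" using c0_norm_le[of "0 :: nat \<Rightarrow> 'k" 0] nn[OF z] by simp
  fix x assume x: "x \<in> vecs ?c"
  show "0 \<le> qnorm c0 x" by (rule nn[OF x])
  show "x = 0" if "qnorm c0 x = 0" using norm_le_c0[OF x] that by (auto simp: fun_eq_iff)
  have sm: "smul ?c c x \<in> vecs ?c" for c
    using x tendsto_mult_right_zero[of x sequentially c] by (simp add: c0_def)
  then show "smul ?c c x \<in> vecs ?c" for c .
  show "qnorm c0 (smul ?c c x) = norm c * qnorm c0 x" for c
  proof -
    have "(SUP n. norm c * norm (x n)) = norm c * (SUP n. norm (x n))"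
    proof (cases "c = 0")
      case False
      show ?thesis
      proof (rule antisym)
        show "(SUP n. norm c * norm (x n)) \<le> norm c * (SUP n. norm (x n))"
          using x by (intro cSUP_least mult_left_mono cSUP_upper c0_bounded) (auto simp: c0_def)
        have "bdd_above (range (\<lambda>n. norm c * norm (x n)))"
          using c0_bounded[of "smul ?c c x"] sm[of c] by (simp add: c0_def norm_mult)
        then have "(SUP n. norm (x n)) \<le> (SUP n. norm c * norm (x n)) / norm c"
          using False by (intro cSUP_least) (auto simp: field_simps intro: cSUP_upper2)
        then show "norm c * (SUP n. norm (x n)) \<le> (SUP n. norm c * norm (x n))"
          using False by (simp add: field_simps)
      qed
    qed simp
    then show ?thesis by (simp add: c0_def norm_mult)
  qed
  fix y assume y: "y \<in> vecs ?c"
  show "x + y \<in> vecs ?c" using x y tendsto_add[of x 0 sequentially y 0] by (simp add: c0_def plus_fun_def)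
  show "qnorm c0 (x + y) \<le> 1 * (qnorm c0 x + qnorm c0 y)"
    using norm_le_c0[OF x] norm_le_c0[OF y] by (auto intro!: c0_norm_le norm_triangle_mono)
qed

section \<open>The bidual embedding and the envelope as a normed space\<close>

lemma bidual_embedding_diff_bound:
  fixes S :: "('k::real_normed_field, 'v::ab_group_add) qspace"
  assumes "K \<ge> 0" and S: "quasi_normed_space S"
    and "\<And>f. f \<in> vecs (dual S) \<Longrightarrow> norm (f x - \<Phi> f) \<le> K * qnorm (dual S) f"
  shows "qnorm (dual (dual S)) (bidual_embedding S x - \<Phi>) \<le> K"
  using assms quasi_normed_space_if_normed[OF normed_space_dual[OF S]]
  by (intro qnorm_dual_le) (auto simp: bidual_embedding_def)

lemma bidual_embedding_mem:
  fixes S :: "('k::real_normed_field, 'v::ab_group_add) qspace"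
  assumes S: "quasi_normed_space S" and x: "x \<in> vecs S"
  shows "bidual_embedding S x \<in> vecs (dual (dual S))"
proof -
  have S': "quasi_normed_space (dual S)" by (rule quasi_normed_space_if_normed[OF normed_space_dual[OF S]])
  note D = quasi_norm_constD[OF normed_space_dual[OF S, unfolded normed_space_def]]
  obtain \<Delta> where "quasi_norm_const S \<Delta>" using S by (auto simp: quasi_normed_space_def)
  then have "0 \<le> qnorm S x" using quasi_norm_constD(6) x by blast
  moreover have "norm (bidual_embedding S x f) \<le> qnorm S x * qnorm (dual S) f" if "f \<in> vecs (dual S)" for f
    using norm_dual_apply_le(2)[OF S that x] that by (simp add: bidual_embedding_def mult.commute)
  moreover have "linear_on (dual S) (*) (bidual_embedding S x)"
    using D(3,5) by (simp add: linear_on_def bidual_embedding_def) (simp add: dual_def)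
  moreover have "bidual_embedding S x f = 0" if "f \<notin> vecs (dual S)" for f
    using that by (simp add: bidual_embedding_def)
  ultimately show ?thesis unfolding mem_dual_iff[OF S'] by blast
qed

lemma banach_envelope_simps [simp]:
  "smul (banach_envelope S) = fun_scale" "qnorm (banach_envelope S) = qnorm (dual (dual S))"
  by (simp_all add: banach_envelope_def dual_def)

text \<open>The closure in the bidual topology becomes approximation in the bidual norm, the form in
  which envelope elements are used below.\<close>

lemma mem_banach_envelope_iff:
  fixes S :: "('k::real_normed_field, 'v::ab_group_add) qspace"
  assumes S: "quasi_normed_space S"
  shows "\<Phi> \<in> vecs (banach_envelope S) \<longleftrightarrow> \<Phi> \<in> vecs (dual (dual S)) \<and>
    (\<forall>e>0. \<exists>x\<in>vecs S. qnorm (dual (dual S)) (bidual_embedding S x - \<Phi>) < e)"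
proof -
  have "quasi_normed_space (dual (dual S))"
    by (intro quasi_normed_space_if_normed normed_space_dual S)
  moreover have "bidual_embedding S ` vecs S \<subseteq> vecs (dual (dual S))"
    using bidual_embedding_mem[OF S] by blast
  ultimately show ?thesis by (simp add: banach_envelope_def closure_of_qtopology)
qed

text \<open>The norm axioms are inherited from the bidual. What remains is that the closure of a
  subspace is a subspace, shown by adding and scaling approximants.\<close>

lemma normed_space_banach_envelope:
  fixes S :: "('k::real_normed_field, 'v::ab_group_add) qspace"
  assumes S: "quasi_normed_space S"
  shows "normed_space (banach_envelope S)"
  unfolding normed_space_def
proof (rule quasi_norm_constI)
  let ?D = "dual (dual S)" and ?E = "banach_envelope S" and ?\<delta> = "bidual_embedding S"
  note I = mem_banach_envelope_iff[OF S]
  note D = quasi_norm_constD[OF normed_space_dual[OF quasi_normed_space_if_normed[OF normed_space_dual[OF S]], unfolded normed_space_def]]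
  have smD: "smul ?D = fun_scale" by (simp add: dual_def)
  note \<delta> = bidual_embedding_mem[OF S]
  obtain \<Delta> where "quasi_norm_const S \<Delta>" using S by (auto simp: quasi_normed_space_def)
  note DS = quasi_norm_constD[OF this]
  have lin: "linear_on S (*) f" if "f \<in> vecs (dual S)" for f using that mem_dual_iff[OF S] by blast
  have \<delta>_add: "?\<delta> (x + y) = ?\<delta> x + ?\<delta> y" if "x \<in> vecs S" "y \<in> vecs S" for x y
    using lin that by (auto simp: fun_eq_iff bidual_embedding_def linear_on_def)
  have \<delta>_scale: "?\<delta> (smul S c x) = fun_scale c (?\<delta> x)" if "x \<in> vecs S" for c x
    using lin that by (auto simp: fun_eq_iff bidual_embedding_def linear_on_def)
  have dualD: "\<Phi> \<in> vecs ?D" if "\<Phi> \<in> vecs ?E" for \<Phi> using that I by blast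
  show "vector_space (smul ?E)" by (simp add: vector_space_fun_scale)
  show "qnorm ?E 0 = 0" using D(7)[OF D(2)] by simp
  have "?\<delta> 0 = 0" using \<delta>_scale[OF DS(2), of 0] \<delta>_add[OF DS(2) DS(2)] by simp
  then show "0 \<in> vecs ?E" unfolding I using DS(2) D(2) D(7)[OF D(2)] by force
  fix \<Phi> assume \<Phi>: "\<Phi> \<in> vecs ?E"
  note \<Phi>D = dualD[OF \<Phi>]
  show "0 \<le> qnorm ?E \<Phi>" using D(6)[OF \<Phi>D] by simp
  show "\<Phi> = 0" if "qnorm ?E \<Phi> = 0" using that D(7)[OF \<Phi>D] by simp
  show "qnorm ?E (smul ?E c \<Phi>) = norm c * qnorm ?E \<Phi>" for c using D(8)[OF \<Phi>D, of c] by (simp add: smD)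
  show "smul ?E c \<Phi> \<in> vecs ?E" for c
    unfolding I banach_envelope_simps
  proof (intro conjI allI impI)
    show "fun_scale c \<Phi> \<in> vecs ?D" using D(5)[OF \<Phi>D, of c] by (simp add: smD)
    fix e :: real assume "e > 0"
    \<comment> \<open>Adding 1 gives a positive divisor even for \<open>c = 0\<close>.\<close>
    have p: "norm c + 1 > 0" by (simp add: add_nonneg_pos)
    with \<open>e > 0\<close> have "e / (norm c + 1) > 0" by simp
    then obtain x where x: "x \<in> vecs S" "qnorm ?D (?\<delta> x - \<Phi>) < e / (norm c + 1)" using \<Phi> I by blast
    have "?\<delta> (smul S c x) - fun_scale c \<Phi> = fun_scale c (?\<delta> x - \<Phi>)"
      using \<delta>_scale[OF x(1)] by (simp add: fun_eq_iff algebra_simps)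
    then have "qnorm ?D (?\<delta> (smul S c x) - fun_scale c \<Phi>) = norm c * qnorm ?D (?\<delta> x - \<Phi>)"
      using D(8)[OF D(4)[OF \<delta>[OF x(1)] \<Phi>D], of c] by (simp add: smD)
    also have "\<dots> \<le> (norm c + 1) * qnorm ?D (?\<delta> x - \<Phi>)"
      using D(6)[OF D(4)[OF \<delta>[OF x(1)] \<Phi>D]] by (intro mult_right_mono) auto
    also have "\<dots> < e" using mult_strict_left_mono[OF x(2) p] p by simp
    finally show "\<exists>x\<in>vecs S. qnorm ?D (?\<delta> x - fun_scale c \<Phi>) < e" using DS(5)[OF x(1)] by blast
  qed
  fix \<Psi> assume \<Psi>: "\<Psi> \<in> vecs ?E"
  note \<Psi>D = dualD[OF \<Psi>]
  show "qnorm ?E (\<Phi> + \<Psi>) \<le> 1 * (qnorm ?E \<Phi> + qnorm ?E \<Psi>)" using D(9)[OF \<Phi>D \<Psi>D] by simp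
  show "\<Phi> + \<Psi> \<in> vecs ?E"
    unfolding I
  proof (intro conjI allI impI)
    show "\<Phi> + \<Psi> \<in> vecs ?D" by (rule D(3)[OF \<Phi>D \<Psi>D])
    fix e :: real assume "e > 0"
    then have e: "e / 2 > 0" by simp
    obtain x where x: "x \<in> vecs S" "qnorm ?D (?\<delta> x - \<Phi>) < e / 2" using e \<Phi> I by blast
    obtain y where y: "y \<in> vecs S" "qnorm ?D (?\<delta> y - \<Psi>) < e / 2" using e \<Psi> I by blast
    have "?\<delta> (x + y) - (\<Phi> + \<Psi>) = (?\<delta> x - \<Phi>) + (?\<delta> y - \<Psi>)" using \<delta>_add[OF x(1) y(1)] by simp
    then have "qnorm ?D (?\<delta> (x + y) - (\<Phi> + \<Psi>)) = qnorm ?D ((?\<delta> x - \<Phi>) + (?\<delta> y - \<Psi>))"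
      by (rule arg_cong)
    also have "\<dots> \<le> 1 * (qnorm ?D (?\<delta> x - \<Phi>) + qnorm ?D (?\<delta> y - \<Psi>))"
      by (rule D(9)[OF D(4)[OF \<delta>[OF x(1)] \<Phi>D] D(4)[OF \<delta>[OF y(1)] \<Psi>D]])
    also have "\<dots> < e" using x(2) y(2) by simp
    finally show "\<exists>z\<in>vecs S. qnorm ?D (?\<delta> z - (\<Phi> + \<Psi>)) < e" using DS(3)[OF x(1) y(1)] by blast
  qed
qed

section \<open>Weak spaces of submeasures\<close>

definition level :: "(nat set \<Rightarrow> nat) \<Rightarrow> (nat \<Rightarrow> 'k::real_normed_field) \<Rightarrow> real \<Rightarrow> real"
  where "level \<phi> x t = t * real (\<phi> {n. t \<le> norm (x n)})"

text \<open>
  The weak-\<open>L\<^sub>1\<close> quasi-norm of the submeasure \<open>\<phi>\<close>. The condition at \<open>0\<close> makes the finitely supported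
  sequences dense.
\<close>

definition weak_space :: "(nat set \<Rightarrow> nat) \<Rightarrow> ('k::real_normed_field, nat \<Rightarrow> 'k) qspace"
  where "weak_space \<phi> =
    \<lparr> vecs = {x. x \<longlonglongrightarrow> 0 \<and> (level \<phi> x \<longlongrightarrow> 0) (at_right 0)},
      smul = fun_scale,
      qnorm = (\<lambda>x. SUP t\<in>{0<..}. level \<phi> x t) \<rparr>"

definition trunc :: "nat \<Rightarrow> (nat \<Rightarrow> 'k::zero) \<Rightarrow> nat \<Rightarrow> 'k"
  where "trunc N x = (\<lambda>n. if n < N then x n else 0)"

text \<open>
  In \<open>cover\<close>, a finite set \<open>F\<close> has fractional covering number at most \<open>C\<close> by subsets of submeasure at
  most 1: a uniformly random \<open>B i\<close> contains each point of \<open>F\<close> with probability at least \<open>1 / C\<close>.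
\<close>

locale covered_submeasure =
  fixes \<phi> :: "nat set \<Rightarrow> nat" and C :: real
  assumes C: "C \<ge> 1"
    and empty: "\<phi> {} = 0"
    and mono: "\<And>A B. finite B \<Longrightarrow> A \<subseteq> B \<Longrightarrow> \<phi> A \<le> \<phi> B"
    and subadditive: "\<And>A B. finite A \<Longrightarrow> finite B \<Longrightarrow> \<phi> (A \<union> B) \<le> \<phi> A + \<phi> B"
    and positive: "\<And>A. finite A \<Longrightarrow> A \<noteq> {} \<Longrightarrow> 1 \<le> \<phi> A"
    and cover: "\<And>F. finite F \<Longrightarrow> \<exists>P::nat. \<exists>B. 0 < P \<and> (\<forall>i<P. B i \<subseteq> F \<and> \<phi> (B i) \<le> 1) \<and>
      (\<forall>n\<in>F. real P \<le> C * real (card {i. i < P \<and> n \<in> B i}))"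
    and unbounded: "\<And>m. \<exists>F. finite F \<and> m < \<phi> F"
begin

section \<open>Level sets and the quasi-norm of the weak space\<close>

lemma finite_level_set:
  fixes x :: "nat \<Rightarrow> 'k::real_normed_field"
  assumes "x \<longlonglongrightarrow> 0" "t > 0"
  shows "finite {n. t \<le> norm (x n)}"
proof -
  obtain N where "\<And>n. n \<ge> N \<Longrightarrow> norm (x n) < t"
    using LIMSEQ_D[OF assms] by auto
  then have "n < N" if "t \<le> norm (x n)" for n using that by (meson not_le)
  then have "{n. t \<le> norm (x n)} \<subseteq> {..<N}" by blast
  then show ?thesis by (rule finite_subset) simp
qed

lemma level_nonneg: "t > 0 \<Longrightarrow> 0 \<le> level \<phi> x t"
  by (simp add: level_def)

lemma level_mono:
  fixes x y :: "nat \<Rightarrow> 'k::real_normed_field"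
  assumes "y \<longlonglongrightarrow> 0" "\<And>n. norm (x n) \<le> norm (y n)" "t > 0"
  shows "level \<phi> x t \<le> level \<phi> y t"
proof -
  have "{n. t \<le> norm (x n)} \<subseteq> {n. t \<le> norm (y n)}" using assms(2) by (auto intro: order_trans)
  then have "\<phi> {n. t \<le> norm (x n)} \<le> \<phi> {n. t \<le> norm (y n)}"
    by (rule mono[OF finite_level_set[OF assms(1,3)]])
  then show ?thesis using assms(3) by (simp add: level_def)
qed

text \<open>Where the sum is at least \<open>t\<close>, one of the summands is at least
  \<open>t / 2\<close>. Writing \<open>t\<close> as twice \<open>t / 2\<close> produces the factor
  2, which becomes the constant of the quasi-norm.\<close>

lemma level_add:
  fixes x y :: "nat \<Rightarrow> 'k::real_normed_field"
  assumes "x \<longlonglongrightarrow> 0" "y \<longlonglongrightarrow> 0" "t > 0"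
  shows "level \<phi> (x + y) t \<le> 2 * (level \<phi> x (t / 2) + level \<phi> y (t / 2))"
proof -
  let ?A = "{n. t / 2 \<le> norm (x n)}" and ?B = "{n. t / 2 \<le> norm (y n)}"
  have fin: "finite ?A" "finite ?B" 
    using finite_level_set[OF assms(1), of "t / 2"] finite_level_set[OF assms(2), of "t / 2"] assms(3) by simp_all
  have "n \<in> ?A \<union> ?B" if "t \<le> norm ((x + y) n)" for n
    using that norm_triangle_ineq[of "x n" "y n"] by auto
  then have "\<phi> {n. t \<le> norm ((x + y) n)} \<le> \<phi> (?A \<union> ?B)" using fin by (intro mono) auto
  also have "\<dots> \<le> \<phi> ?A + \<phi> ?B" by (rule subadditive[OF fin])
  finally have "t * real (\<phi> {n. t \<le> norm ((x + y) n)}) \<le> t * real (\<phi> ?A + \<phi> ?B)"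
    using assms(3) by (intro mult_left_mono) auto
  then show ?thesis by (simp add: level_def algebra_simps)
qed

lemma level_scale:
  fixes x :: "nat \<Rightarrow> 'k::real_normed_field"
  assumes "c \<noteq> 0"
  shows "level \<phi> (fun_scale c x) t = norm c * level \<phi> x (t / norm c)"
  using assms by (simp add: level_def norm_mult field_simps)

lemma level_eq_0:
  assumes "\<And>n. norm (x n) < t"
  shows "level \<phi> x t = 0"
proof -
  have "{n. t \<le> norm (x n)} = {}" using assms by (auto simp: not_le)
  then show ?thesis by (simp add: level_def empty)
qed

lemma mem_weak_space_iff:
  fixes x :: "nat \<Rightarrow> 'k::real_normed_field"
  shows "x \<in> vecs (weak_space \<phi>) \<longleftrightarrow>
    x \<longlonglongrightarrow> 0 \<and> (\<forall>e>0. \<exists>d>0. \<forall>t. 0 < t \<and> t < d \<longrightarrow> level \<phi> x t < e)"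
proof -
  have "(level \<phi> x \<longlongrightarrow> 0) (at_right 0) \<longleftrightarrow>
    (\<forall>e>0. \<exists>d>0. \<forall>t>0. t < d \<longrightarrow> dist (level \<phi> x t) 0 < e)"
    unfolding tendsto_iff eventually_at_right_field ..
  also have "\<dots> \<longleftrightarrow> (\<forall>e>0. \<exists>d>0. \<forall>t. 0 < t \<and> t < d \<longrightarrow> level \<phi> x t < e)"
  proof -
    have "(\<forall>t>0. t < d \<longrightarrow> dist (level \<phi> x t) 0 < e) \<longleftrightarrow> (\<forall>t. 0 < t \<and> t < d \<longrightarrow> level \<phi> x t < e)" for d e
      using level_nonneg[of _ x] by (auto simp: dist_real_def)
    then show ?thesis by simp
  qed
  finally show ?thesis by (simp add: weak_space_def)
qed

lemma weak_spaceI: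
  fixes x :: "nat \<Rightarrow> 'k::real_normed_field"
  assumes "x \<longlonglongrightarrow> 0"
    and "\<And>e. e > 0 \<Longrightarrow> \<exists>d>0. \<forall>t. 0 < t \<and> t < d \<longrightarrow> level \<phi> x t < e"
  shows "x \<in> vecs (weak_space \<phi>)"
  unfolding mem_weak_space_iff using assms by blast

lemma weak_spaceE:
  fixes x :: "nat \<Rightarrow> 'k::real_normed_field"
  assumes "x \<in> vecs (weak_space \<phi>)" "e > 0"
  obtains d where "d > 0" "\<And>t. 0 < t \<Longrightarrow> t < d \<Longrightarrow> level \<phi> x t < e"
proof -
  have "\<exists>d>0. \<forall>t. 0 < t \<and> t < d \<longrightarrow> level \<phi> x t < e"
    using assms unfolding mem_weak_space_iff by (elim conjE allE impE) assumption+
  then show thesis using that by (elim exE conjE) simp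
qed

lemma weak_space_tendsto: "x \<in> vecs (weak_space \<phi>) \<Longrightarrow> x \<longlonglongrightarrow> 0"
  by (simp add: weak_space_def)

text \<open>The point is that the supremum is finite: near 0 the levels are below 1 by membership,
  above the sup norm they vanish, and in between the level sets lie in one fixed finite set.\<close>

lemma level_le_qnorm:
  fixes x :: "nat \<Rightarrow> 'k::real_normed_field"
  assumes x: "x \<in> vecs (weak_space \<phi>)" and t: "t > 0"
  shows "level \<phi> x t \<le> qnorm (weak_space \<phi>) x"
proof -
  note x0 = weak_space_tendsto[OF x]
  obtain d where d: "d > 0" "\<And>t. 0 < t \<Longrightarrow> t < d \<Longrightarrow> level \<phi> x t < 1"
    using weak_spaceE[OF x zero_less_one] by metis
  obtain r where r: "\<And>n. norm (x n) \<le> r" using c0_bounded[OF x0] by (auto simp: bdd_above_def)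
  let ?K = "max 1 (r * real (\<phi> {n. d \<le> norm (x n)}))"
  have "level \<phi> x s \<le> ?K" if s: "s > 0" for s
  proof -
    consider "s < d" | "s > r" | "d \<le> s" "s \<le> r" by linarith
    then show ?thesis
    proof cases
      case 2
      then have "level \<phi> x s = 0" using r by (intro level_eq_0) (meson le_less_trans)
      then show ?thesis by simp
    next
      case 3
      have "\<phi> {n. s \<le> norm (x n)} \<le> \<phi> {n. d \<le> norm (x n)}"
        using 3 by (intro mono finite_level_set[OF x0 d(1)]) auto
      then have "level \<phi> x s \<le> r * real (\<phi> {n. d \<le> norm (x n)})"
        unfolding level_def using 3 s by (intro mult_mono) auto
      then show ?thesis by simp
    qed (use d(2)[OF s] in simp)
  qed
  then have "bdd_above (level \<phi> x ` {0<..})" by (intro bdd_aboveI2) auto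
  then show ?thesis using t by (simp add: weak_space_def cSUP_upper)
qed

lemma qnorm_weak_le: "(\<And>t. t > 0 \<Longrightarrow> level \<phi> x t \<le> K) \<Longrightarrow> qnorm (weak_space \<phi>) x \<le> K"
  by (auto simp: weak_space_def intro!: cSUP_least)

lemma qnorm_weak_nonneg: "x \<in> vecs (weak_space \<phi>) \<Longrightarrow> 0 \<le> qnorm (weak_space \<phi>) x"
  using level_le_qnorm[of x 1] level_nonneg[of 1 x] by simp

text \<open>The level set at height \<open>norm (x n)\<close> contains \<open>n\<close>, so its
  submeasure is at least 1. This makes the quasi-norm definite and the coordinates
  continuous.\<close>

lemma norm_le_qnorm_weak:
  fixes x :: "nat \<Rightarrow> 'k::real_normed_field"
  assumes x: "x \<in> vecs (weak_space \<phi>)"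
  shows "norm (x n) \<le> qnorm (weak_space \<phi>) x"
proof (cases "x n = 0")
  case False
  then have p: "norm (x n) > 0" by simp
  have "1 \<le> \<phi> {m. norm (x n) \<le> norm (x m)}"
    by (rule positive[OF finite_level_set[OF weak_space_tendsto[OF x] p]]) auto
  then have "norm (x n) * 1 \<le> level \<phi> x (norm (x n))"
    unfolding level_def by (intro mult_left_mono) auto
  then show ?thesis using level_le_qnorm[OF x p] by simp
qed (use qnorm_weak_nonneg[OF x] in simp)

lemma quasi_norm_const_weak: "quasi_norm_const (weak_space \<phi> :: ('k::real_normed_field, nat \<Rightarrow> 'k) qspace) 2"
proof (rule quasi_norm_constI)
  let ?X = "weak_space \<phi> :: ('k, nat \<Rightarrow> 'k) qspace"
  have sm: "smul ?X = fun_scale" by (simp add: weak_space_def)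
  show "vector_space (smul ?X)" unfolding sm by (rule vector_space_fun_scale)
  have l0: "level \<phi> (0 :: nat \<Rightarrow> 'k) t = 0" if "t > 0" for t using that by (intro level_eq_0) simp
  have "(0 :: nat \<Rightarrow> 'k) \<longlonglongrightarrow> 0" by (simp add: zero_fun_def)
  then show z: "0 \<in> vecs ?X"
    by (rule weak_spaceI) (rule exI[of _ "1 :: real"], simp add: l0)
  show q0: "qnorm ?X 0 = 0"
  proof (rule antisym)
    show "qnorm ?X 0 \<le> 0" by (rule qnorm_weak_le) (simp add: l0)
  qed (rule qnorm_weak_nonneg[OF z])
  fix x assume x: "x \<in> vecs ?X"
  note x0 = weak_space_tendsto[OF x]
  show "0 \<le> qnorm ?X x" by (rule qnorm_weak_nonneg[OF x])
  show "x = 0" if "qnorm ?X x = 0" using norm_le_qnorm_weak[OF x] that by (auto simp: fun_eq_iff)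
  have sc: "smul ?X c x \<in> vecs ?X \<and> qnorm ?X (smul ?X c x) \<le> norm c * qnorm ?X x"
    if x: "x \<in> vecs ?X" for c x
  proof (cases "c = 0")
    case True
    then have "smul ?X c x = 0" by (simp add: sm fun_eq_iff)
    then show ?thesis using z q0 True by simp
  next
    case False
    then have c: "norm c > 0" by simp
    have "\<exists>d>0. \<forall>t. 0 < t \<and> t < d \<longrightarrow> level \<phi> (fun_scale c x) t < e" if "e > 0" for e
    proof -
      obtain d where d: "d > 0" "\<And>t. 0 < t \<Longrightarrow> t < d \<Longrightarrow> level \<phi> x t < e / norm c"
        using weak_spaceE[OF x divide_pos_pos[OF \<open>e > 0\<close> c]] by metis
      have "level \<phi> (fun_scale c x) t < e" if "0 < t" "t < d * norm c" for t
        using d(2)[of "t / norm c"] that c by (simp add: level_scale[OF False] field_simps)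
      then show ?thesis using d c by (intro exI[of _ "d * norm c"]) simp
    qed
    moreover have "fun_scale c x \<longlonglongrightarrow> 0"
      using tendsto_mult_right_zero[OF weak_space_tendsto[OF x], of c] .
    moreover have "qnorm ?X (fun_scale c x) \<le> norm c * qnorm ?X x"
      using c by (intro qnorm_weak_le) (simp add: level_scale[OF False] level_le_qnorm[OF x])
    ultimately show ?thesis unfolding sm using weak_spaceI[of "fun_scale c x"] by simp
  qed
  show "smul ?X c x \<in> vecs ?X" for c using sc[OF x] by blast
  show "qnorm ?X (smul ?X c x) = norm c * qnorm ?X x" for c
  proof (cases "c = 0")
    case True
    then show ?thesis using sc[OF x, of c] qnorm_weak_nonneg[of "smul ?X c x"] by simp
  next
    case False
    have "smul ?X (1 / c) (smul ?X c x) = x" using False by (simp add: sm)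
    then have "qnorm ?X x \<le> norm (1 / c) * qnorm ?X (smul ?X c x)"
      using sc[of "smul ?X c x" "1 / c"] sc[OF x, of c] by simp
    then have "norm c * qnorm ?X x \<le> qnorm ?X (smul ?X c x)"
      using False by (simp add: norm_divide field_simps)
    then show ?thesis using sc[OF x, of c] by simp
  qed
  fix y assume y: "y \<in> vecs ?X"
  note y0 = weak_space_tendsto[OF y]
  have "\<exists>d>0. \<forall>t. 0 < t \<and> t < d \<longrightarrow> level \<phi> (x + y) t < e" if "e > 0" for e
  proof -
    \<comment> \<open>Two levels below \<open>e / 4\<close> at \<open>t / 2\<close> give less than
      \<open>2 * (e / 4 + e / 4) = e\<close> through \<open>level_add\<close>.\<close>
    have "e / 4 > 0" using that by simp
    obtain d where d: "d > 0" "\<And>t. 0 < t \<Longrightarrow> t < d \<Longrightarrow> level \<phi> x t < e / 4"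
      using weak_spaceE[OF x \<open>e / 4 > 0\<close>] by metis
    obtain d' where d': "d' > 0" "\<And>t. 0 < t \<Longrightarrow> t < d' \<Longrightarrow> level \<phi> y t < e / 4"
      using weak_spaceE[OF y \<open>e / 4 > 0\<close>] by metis
    have "level \<phi> (x + y) t < e" if "0 < t" "t < min d d'" for t
      using level_add[OF x0 y0 that(1)] d(2)[of "t / 2"] d'(2)[of "t / 2"] that by simp
    then show ?thesis using d d' by (intro exI[of _ "min d d'"]) simp
  qed
  moreover have "x + y \<longlonglongrightarrow> 0" using tendsto_add[OF x0 y0] by (simp add: plus_fun_def)
  ultimately show "x + y \<in> vecs ?X" using weak_spaceI by metis
  show "qnorm ?X (x + y) \<le> 2 * (qnorm ?X x + qnorm ?X y)"
  proof (rule qnorm_weak_le)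
    fix t :: real assume "t > 0"
    then show "level \<phi> (x + y) t \<le> 2 * (qnorm ?X x + qnorm ?X y)"
      using level_add[OF x0 y0, of t] level_le_qnorm[OF x, of "t / 2"] level_le_qnorm[OF y, of "t / 2"] by simp
  qed
qed

lemmas weakD = quasi_norm_constD[OF quasi_norm_const_weak]

lemma smul_weak: "smul (weak_space \<phi>) = fun_scale"
  by (simp add: weak_space_def)

lemma quasi_normed_space_weak: "quasi_normed_space (weak_space \<phi>)"
  unfolding quasi_normed_space_def using quasi_norm_const_weak by (intro exI[of _ 2]) simp

text \<open>Coordinates are dominated by the quasi-norm, so a coordinatewise limit \<open>l\<close>
  exists and the convergence is uniform. The Cauchy estimate is then carried over to
  \<open>s n - l\<close> at the cost of a factor 2.\<close>

lemma complete_weak: "complete_qspace (weak_space \<phi> :: ('k::{real_normed_field, banach}, nat \<Rightarrow> 'k) qspace)"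
  unfolding complete_qspace_def
proof (intro allI impI, elim conjE)
  let ?X = "weak_space \<phi> :: ('k, nat \<Rightarrow> 'k) qspace"
  fix s :: "nat \<Rightarrow> nat \<Rightarrow> 'k"
  assume s': "\<forall>n. s n \<in> vecs ?X"
    and cauchy: "\<forall>e>0. \<exists>M. \<forall>m\<ge>M. \<forall>n\<ge>M. qnorm ?X (s m - s n) < e"
  then have s: "s n \<in> vecs ?X" for n by blast
  have sd: "s m - s n \<in> vecs ?X" for m n by (rule weakD(4)[OF s s])
  have coord: "norm (s m k - s n k) \<le> qnorm ?X (s m - s n)" for m n k
    using norm_le_qnorm_weak[OF sd, of m n k] by simp
  have "Cauchy (\<lambda>n. s n k)" for k
  proof (rule CauchyI)
    fix e :: real assume "e > 0"
    then obtain M where M: "\<And>m n. m \<ge> M \<Longrightarrow> n \<ge> M \<Longrightarrow> qnorm ?X (s m - s n) < e"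
      using cauchy by blast
    have "norm (s m k - s n k) < e" if "m \<ge> M" "n \<ge> M" for m n
      using M[OF that] coord[of m k n] by simp
    then show "\<exists>M. \<forall>m\<ge>M. \<forall>n\<ge>M. norm (s m k - s n k) < e" by blast
  qed
  then have "\<exists>L. (\<lambda>n. s n k) \<longlonglongrightarrow> L" for k
    using Cauchy_convergent[of "\<lambda>n. s n k"] by (simp add: convergent_def)
  then obtain l where l: "\<And>k. (\<lambda>n. s n k) \<longlonglongrightarrow> l k" by metis
  have sup: "norm (s n k - l k) \<le> e"
    if e: "\<And>m n. m \<ge> M \<Longrightarrow> n \<ge> M \<Longrightarrow> qnorm ?X (s m - s n) < e" and n: "n \<ge> M" for e M n k
  proof (rule LIMSEQ_le_const2)
    show "(\<lambda>m. norm (s n k - s m k)) \<longlonglongrightarrow> norm (s n k - l k)" by (intro tendsto_intros l)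
    have "norm (s n k - s m k) \<le> e" if "m \<ge> M" for m using coord[of n k m] e[OF n that] by simp
    then show "\<exists>N. \<forall>m\<ge>N. norm (s n k - s m k) \<le> e" by blast
  qed
  have l0: "l \<longlonglongrightarrow> 0"
  proof (rule LIMSEQ_I)
    fix e :: real assume "e > 0"
    then have "e / 2 > 0" by simp
    then obtain M where "\<And>m n. m \<ge> M \<Longrightarrow> n \<ge> M \<Longrightarrow> qnorm ?X (s m - s n) < e / 2"
      using cauchy by blast
    then have M: "norm (s M k - l k) \<le> e / 2" for k using sup[of M "e / 2" M k] by simp
    obtain N where N: "\<And>k. k \<ge> N \<Longrightarrow> norm (s M k) < e / 2"
      using LIMSEQ_D[OF weak_space_tendsto[OF s[of M]], of "e / 2"] \<open>e > 0\<close> by auto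
    have "norm (l k - 0) < e" if "k \<ge> N" for k
      using M[of k] N[OF that] norm_triangle_ineq3[of "s M k" "l k"] by simp
    then show "\<exists>N. \<forall>k\<ge>N. norm (l k - 0) < e" by blast
  qed
  \<comment> \<open>The submeasure has no continuity to rely on. Instead, the level set of
    \<open>s n - l\<close> at \<open>t\<close> is finite, so one late \<open>s m\<close> is within
    \<open>t / 2\<close> of \<open>l\<close> on all of it, and the set lies in the level set of
    \<open>s n - s m\<close> at \<open>t / 2\<close>.\<close>
  have close: "level \<phi> (s n - l) t \<le> 2 * e"
    if e: "\<And>m n. m \<ge> M \<Longrightarrow> n \<ge> M \<Longrightarrow> qnorm ?X (s m - s n) < e" and n: "n \<ge> M" and t: "t > 0" for e M n t
  proof -
    let ?A = "{k. t \<le> norm ((s n - l) k)}"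
    have "s n - l \<longlonglongrightarrow> 0" using tendsto_diff[OF weak_space_tendsto[OF s[of n]] l0] by (simp add: fun_diff_def)
    then have A: "finite ?A" using t by (rule finite_level_set)
    have "\<forall>\<^sub>F m in sequentially. norm (s m k - l k) < t / 2" for k
      using tendstoD[OF l[of k], of "t / 2"] t by (simp add: dist_norm)
    then have "\<forall>\<^sub>F m in sequentially. \<forall>k\<in>?A. norm (s m k - l k) < t / 2"
      by (rule eventually_ball_finite[OF A, OF ballI])
    then obtain m' where m': "\<forall>m\<ge>m'. \<forall>k\<in>?A. norm (s m k - l k) < t / 2"
      unfolding eventually_sequentially by (elim exE)
    define m where "m = max M m'"
    have m: "m \<ge> M" "\<And>k. k \<in> ?A \<Longrightarrow> norm (s m k - l k) < t / 2"
      using m'[rule_format, of m] by (simp_all add: m_def)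
    have "?A \<subseteq> {k. t / 2 \<le> norm ((s n - s m) k)}"
    proof
      fix k assume k: "k \<in> ?A"
      have "norm (s n k - l k) \<le> norm (s n k - s m k) + norm (s m k - l k)"
        using norm_triangle_ineq[of "s n k - s m k" "s m k - l k"] by simp
      then show "k \<in> {k. t / 2 \<le> norm ((s n - s m) k)}" using k m(2)[OF k] by simp
    qed
    then have "\<phi> ?A \<le> \<phi> {k. t / 2 \<le> norm ((s n - s m) k)}"
      using t by (intro mono finite_level_set weak_space_tendsto[OF sd]) auto
    then have "level \<phi> (s n - l) t \<le> 2 * level \<phi> (s n - s m) (t / 2)"
      using t by (simp add: level_def)
    also have "\<dots> \<le> 2 * e" using level_le_qnorm[OF sd, of "t / 2" n m] e[OF n m(1)] t by simp
    finally show ?thesis .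
  qed
  have lX: "l \<in> vecs ?X"
  proof (rule weak_spaceI[OF l0])
    fix e :: real assume "e > 0"
    \<comment> \<open>Splitting \<open>l\<close> as \<open>s M + (l - s M)\<close> costs
      \<open>2 * (e / 10 + 2 * (e / 10))\<close>, which is below \<open>e\<close>.\<close>
    then have "e / 10 > 0" by simp
    then obtain M where M: "\<And>m n. m \<ge> M \<Longrightarrow> n \<ge> M \<Longrightarrow> qnorm ?X (s m - s n) < e / 10"
      using cauchy by blast
    obtain d where d: "d > 0" "\<And>t. 0 < t \<Longrightarrow> t < d \<Longrightarrow> level \<phi> (s M) t < e / 10"
      using weak_spaceE[OF s \<open>e / 10 > 0\<close>] by metis
    have "level \<phi> l t < e" if t: "0 < t" "t < d" for t
    proof -
      have "l - s M \<longlonglongrightarrow> 0"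
        using tendsto_diff[OF l0 weak_space_tendsto[OF s[of M]]] by (simp add: fun_diff_def)
      then have "level \<phi> (s M + (l - s M)) t \<le> 2 * (level \<phi> (s M) (t / 2) + level \<phi> (l - s M) (t / 2))"
        using level_add[OF weak_space_tendsto[OF s]] t by blast
      moreover have "level \<phi> (l - s M) (t / 2) = level \<phi> (s M - l) (t / 2)"
        by (simp add: level_def norm_minus_commute)
      ultimately show ?thesis using close[where M = M and e = "e / 10" and t = "t / 2", OF M order_refl] d(2)[of "t / 2"] t \<open>e > 0\<close> by simp
    qed
    then show "\<exists>d>0. \<forall>t. 0 < t \<and> t < d \<longrightarrow> level \<phi> l t < e" using d(1) by blast
  qed
  have "(\<lambda>n. qnorm ?X (s n - l)) \<longlonglongrightarrow> 0"
  proof (rule LIMSEQ_I)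
    fix e :: real assume "e > 0"
    then have "e / 4 > 0" by simp
    then obtain M where M: "\<And>m n. m \<ge> M \<Longrightarrow> n \<ge> M \<Longrightarrow> qnorm ?X (s m - s n) < e / 4"
      using cauchy by blast
    have "norm (qnorm ?X (s n - l) - 0) < e" if "n \<ge> M" for n
      using qnorm_weak_le[OF close[where M = M and e = "e / 4", OF M that]] qnorm_weak_nonneg[OF weakD(4)[OF s lX], of n] \<open>e > 0\<close> by simp
    then show "\<exists>M. \<forall>n\<ge>M. norm (qnorm ?X (s n - l) - 0) < e" by blast
  qed
  then show "\<exists>l\<in>vecs ?X. (\<lambda>n. qnorm ?X (s n - l)) \<longlonglongrightarrow> 0" using lX by blast
qed

lemma quasi_banach_space_weak:
  "quasi_banach_space (weak_space \<phi> :: ('k::{real_normed_field, banach}, nat \<Rightarrow> 'k) qspace)"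
  using quasi_normed_space_weak complete_weak by (simp add: quasi_banach_space_def)

section \<open>Finitely supported sequences and the failure of local convexity\<close>

lemma finite_support_weak:
  fixes x :: "nat \<Rightarrow> 'k::real_normed_field"
  assumes F: "finite F" "\<And>n. n \<notin> F \<Longrightarrow> x n = 0" and r: "\<And>n. norm (x n) \<le> r"
  shows "x \<in> vecs (weak_space \<phi>)" "qnorm (weak_space \<phi>) x \<le> r * real (\<phi> F)"
proof -
  have le: "level \<phi> x t \<le> t * real (\<phi> F)" if "t > 0" for t
  proof -
    have "{n. t \<le> norm (x n)} \<subseteq> F" using F(2) that by force
    then show ?thesis using mono[OF F(1)] that by (simp add: level_def)
  qed
  have "level \<phi> x t < e" if "e > 0" "0 < t" "t < e / (real (\<phi> F) + 1)" for e t
  proof -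
    have "t * real (\<phi> F) \<le> t * (real (\<phi> F) + 1)" using that by simp
    also have "\<dots> < e" using that by (simp add: field_simps)
    finally show ?thesis using le[OF that(2)] by simp
  qed
  moreover have "e / (real (\<phi> F) + 1) > 0" if "e > 0" for e using that by simp
  moreover have "x \<longlonglongrightarrow> 0"
  proof (rule tendsto_eventually)
    obtain N where "\<forall>n\<in>F. n < N" using F(1) finite_nat_set_iff_bounded by blast
    then show "\<forall>\<^sub>F n in sequentially. x n = 0"
      unfolding eventually_sequentially using F(2) by (intro exI[of _ N]) (meson not_le)
  qed
  ultimately show "x \<in> vecs (weak_space \<phi>)" using weak_spaceI by metis
  show "qnorm (weak_space \<phi>) x \<le> r * real (\<phi> F)"
  proof (rule qnorm_weak_le)
    fix t :: real assume t: "t > 0"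
    show "level \<phi> x t \<le> r * real (\<phi> F)"
    proof (cases "t \<le> r")
      case True
      then have "t * real (\<phi> F) \<le> r * real (\<phi> F)" by (intro mult_right_mono) auto
      then show ?thesis using le[OF t] by simp
    next
      case False
      then have "level \<phi> x t = 0" using r by (intro level_eq_0) (meson le_less_trans not_le)
      moreover have "0 \<le> r" using r[of 0] norm_ge_zero order_trans by blast
      ultimately show ?thesis by simp
    qed
  qed
qed

lemma trunc_mem_weak: "trunc N x \<in> vecs (weak_space \<phi>)"
  for x :: "nat \<Rightarrow> 'k::real_normed_field"
proof (rule finite_support_weak(1)[of "{..<N}"])
  show "norm (trunc N x n) \<le> (\<Sum>i<N. norm (x i))" for n
    by (auto simp: trunc_def intro!: member_le_sum sum_nonneg)
qed (auto simp: trunc_def)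

text \<open>Levels below \<open>d\<close> are small because of the condition at 0 in
  \<open>weak_space\<close>; levels from \<open>d\<close> on vanish once the tail of
  \<open>x\<close> has sup norm below \<open>d\<close>.\<close>

lemma trunc_converges_weak:
  fixes x :: "nat \<Rightarrow> 'k::real_normed_field"
  assumes x: "x \<in> vecs (weak_space \<phi>)"
  shows "(\<lambda>N. qnorm (weak_space \<phi>) (x - trunc N x)) \<longlonglongrightarrow> 0"
proof (rule LIMSEQ_I)
  note x0 = weak_space_tendsto[OF x]
  fix e :: real assume "e > 0"
  then have "e / 2 > 0" by simp
  then obtain d where d: "d > 0" "\<And>t. 0 < t \<Longrightarrow> t < d \<Longrightarrow> level \<phi> x t < e / 2"
    using weak_spaceE[OF x \<open>e / 2 > 0\<close>] by metis
  obtain M where M: "\<And>n. n \<ge> M \<Longrightarrow> norm (x n) < d" using LIMSEQ_D[OF x0 d(1)] by auto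
  have "norm (qnorm (weak_space \<phi>) (x - trunc N x) - 0) < e" if N: "N \<ge> M" for N
  proof -
    have "level \<phi> (x - trunc N x) t \<le> e / 2" if t: "t > 0" for t
    proof (cases "t < d")
      case True
      have "level \<phi> (x - trunc N x) t \<le> level \<phi> x t" using x0 t by (intro level_mono) (auto simp: trunc_def)
      then show ?thesis using d(2)[OF t True] by simp
    next
      case False
      have "norm ((x - trunc N x) n) < t" for n
        using M[of n] N False t by (auto simp: trunc_def)
      then have "level \<phi> (x - trunc N x) t = 0" by (rule level_eq_0)
      then show ?thesis using \<open>e > 0\<close> by simp
    qed
    then have "qnorm (weak_space \<phi>) (x - trunc N x) \<le> e / 2" by (rule qnorm_weak_le)
    then show ?thesis using qnorm_weak_nonneg[OF weakD(4)[OF x trunc_mem_weak]] \<open>e > 0\<close> by simp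
  qed
  then show "\<exists>M. \<forall>N\<ge>M. norm (qnorm (weak_space \<phi>) (x - trunc N x) - 0) < e" by blast
qed

text \<open>The averaging argument: each \<open>x n\<close> is divided equally among the
  \<open>c n\<close> sets \<open>B i\<close> that contain \<open>n\<close>. Since \<open>c n\<close>
  is at least \<open>P / C\<close>, every piece has sup norm at most \<open>C * r / P\<close>, and
  its support has submeasure at most 1.\<close>

lemma sup_norm_decomposition:
  fixes x :: "nat \<Rightarrow> 'k::real_normed_field"
  assumes F: "finite F" "\<And>n. n \<notin> F \<Longrightarrow> x n = 0" and r: "\<And>n. norm (x n) \<le> r"
  obtains P :: nat and y where "P > 0" "x = (\<Sum>i<P. y i)"
    "\<And>i. i < P \<Longrightarrow> y i \<in> vecs (weak_space \<phi>) \<and> qnorm (weak_space \<phi>) (y i) \<le> C * r / real P"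
proof -
  obtain P :: nat and B where P: "P > 0" and B: "\<And>i. i < P \<Longrightarrow> B i \<subseteq> F \<and> \<phi> (B i) \<le> 1"
    and dens: "\<And>n. n \<in> F \<Longrightarrow> real P \<le> C * real (card {i. i < P \<and> n \<in> B i})"
    using cover[OF F(1)] by blast
  define c where "c n = card {i. i < P \<and> n \<in> B i}" for n
  have cpos: "c n > 0" if "n \<in> F" for n
  proof (rule ccontr)
    assume "\<not> c n > 0"
    moreover have "real P \<le> C * real (c n)" by (rule dens[OF that, folded c_def])
    ultimately show False using P by simp
  qed
  define y where "y i = (\<lambda>n. if n \<in> B i then x n / of_nat (c n) else 0)" for i
  have r0: "0 \<le> r" using r[of 0] norm_ge_zero order_trans by blast
  show thesis
  proof (rule that[OF P, of y])
    show "x = (\<Sum>i<P. y i)"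
    proof
      fix n
      have "(\<Sum>i<P. y i) n = (\<Sum>i<P. y i n)" by (induction P) auto
      also have "\<dots> = (\<Sum>i\<in>{i. i < P \<and> n \<in> B i}. x n / of_nat (c n))"
        unfolding y_def by (intro sum.mono_neutral_cong_right) auto
      also have "\<dots> = of_nat (c n) * (x n / of_nat (c n))" by (simp add: c_def)
      also have "\<dots> = x n" using cpos[of n] F(2)[of n] by (cases "n \<in> F") auto
      finally show "x n = (\<Sum>i<P. y i) n" by simp
    qed
    fix i assume i: "i < P"
    have fin: "finite (B i)" using B[OF i] F(1) finite_subset by blast
    have le: "norm (y i n) \<le> C * r / real P" for n
    proof (cases "n \<in> B i")
      case True
      then have n: "n \<in> F" using B[OF i] by blast
      have "norm (y i n) = norm (x n) / real (c n)" using True by (simp add: y_def norm_divide)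
      also have "\<dots> \<le> r / real (c n)" using r by (intro divide_right_mono) auto
      also have "\<dots> \<le> C * r / real P"
        using mult_left_mono[OF dens[OF n] r0] cpos[OF n] P by (simp add: c_def field_simps)
      finally show ?thesis .
    qed (use C r0 in \<open>simp add: y_def\<close>)
    have z: "y i n = 0" if "n \<notin> B i" for n using that by (simp add: y_def)
    have "C * r / real P * real (\<phi> (B i)) \<le> C * r / real P * 1"
      using B[OF i] C r0 by (intro mult_left_mono) auto
    then show "y i \<in> vecs (weak_space \<phi>) \<and> qnorm (weak_space \<phi>) (y i) \<le> C * r / real P"
      using finite_support_weak(1)[where x = "y i", OF fin z le] order_trans[OF finite_support_weak(2)[where x = "y i", OF fin z le]] by simp
  qed
qed

text \<open>Each of the \<open>P\<close> pieces of the decomposition contributes at most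
  \<open>K * (C * r / P)\<close>. A general \<open>N\<close> covers both uses: a norm equivalent to
  the quasi-norm, and the modulus of a functional.\<close>

lemma subadditive_le_sup_norm:
  fixes N :: "(nat \<Rightarrow> 'k::real_normed_field) \<Rightarrow> real"
  assumes N: "N 0 \<le> 0" "\<And>x y. x \<in> vecs (weak_space \<phi>) \<Longrightarrow> y \<in> vecs (weak_space \<phi>) \<Longrightarrow> N (x + y) \<le> N x + N y"
      "\<And>x. x \<in> vecs (weak_space \<phi>) \<Longrightarrow> N x \<le> K * qnorm (weak_space \<phi>) x" and K: "K \<ge> 0"
    and F: "finite F" "\<And>n. n \<notin> F \<Longrightarrow> x n = 0" and r: "\<And>n. norm (x n) \<le> r"
  shows "N x \<le> K * (C * r)"
proof -
  obtain P :: nat and y where P: "P > 0" "x = (\<Sum>i<P. y i)"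
    and y: "\<And>i. i < P \<Longrightarrow> y i \<in> vecs (weak_space \<phi>) \<and> qnorm (weak_space \<phi>) (y i) \<le> C * r / real P"
    using sup_norm_decomposition[where x = x, OF F r] by blast
  \<comment> \<open>Subadditivity is only available inside the space, so membership of the partial
    sums is carried along in the induction.\<close>
  have "(\<Sum>i<Q. y i) \<in> vecs (weak_space \<phi>) \<and> N (\<Sum>i<Q. y i) \<le> real Q * (K * (C * r / real P))" if "Q \<le> P" for Q
    using that
  proof (induction Q)
    case (Suc Q)
    have "N (y Q) \<le> K * qnorm (weak_space \<phi>) (y Q)" using N(3) y Suc.prems by simp
    also have "\<dots> \<le> K * (C * r / real P)" using y Suc.prems K by (intro mult_left_mono) auto
    finally have "N (y Q) \<le> K * (C * r / real P)" .
    moreover have IH: "(\<Sum>i<Q. y i) \<in> vecs (weak_space \<phi>)"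
        "N (\<Sum>i<Q. y i) \<le> real Q * (K * (C * r / real P))" and yQ: "y Q \<in> vecs (weak_space \<phi>)"
      using Suc y by simp_all
    moreover have "real (Suc Q) * (K * (C * r / real P))
      = real Q * (K * (C * r / real P)) + K * (C * r / real P)"
      unfolding of_nat_Suc distrib_right by simp
    ultimately have "N ((\<Sum>i<Q. y i) + y Q) \<le> real (Suc Q) * (K * (C * r / real P))"
      using N(2)[OF IH(1) yQ] by linarith
    then show ?case unfolding sum.lessThan_Suc using weakD(3)[OF IH(1) yQ] by blast
  qed (use N(1) weakD(2) in auto)
  from this[of P] show ?thesis using P by simp
qed

theorem not_locally_convex_weak: "\<not> locally_convex (weak_space \<phi> :: ('k::{real_normed_field, banach}, nat \<Rightarrow> 'k) qspace)"
proof
  let ?X = "weak_space \<phi> :: ('k, nat \<Rightarrow> 'k) qspace"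
  assume "locally_convex ?X"
  then obtain n where n: "equivalent_norm ?X n"
    using locally_convex_iff_equivalent_norm[OF quasi_banach_space_weak] by blast
  then obtain a b where a: "a > 0" and b: "b > 0"
    and ab: "\<And>x. x \<in> vecs ?X \<Longrightarrow> a * n x \<le> qnorm ?X x \<and> qnorm ?X x \<le> b * n x"
    unfolding equivalent_norm_def by blast
  have nB: "normed_space (?X\<lparr>qnorm := n\<rparr>)" using n by (simp add: equivalent_norm_def)
  note D = quasi_norm_constD[OF nB[unfolded normed_space_def], simplified]
  \<comment> \<open>An equivalent norm is at most \<open>C / a\<close> on the indicator of any
    finite set, which would bound the quasi-norm there by \<open>b * (C / a)\<close>. The set
    \<open>F\<close> is chosen to exceed this value.\<close>
  obtain m :: nat where m: "b * (C / a) \<le> real m" using real_arch_simple by blast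
  obtain F where F: "finite F" "m < \<phi> F" using unbounded by blast
  define x :: "nat \<Rightarrow> 'k" where "x = (\<lambda>i. if i \<in> F then 1 else 0)"
  have x: "x i = 0" if "i \<notin> F" for i using that by (simp add: x_def)
  have nx: "norm (x i) \<le> 1" for i by (simp add: x_def)
  have xX: "x \<in> vecs ?X" by (rule finite_support_weak(1)[where x = x, OF F(1) x nx])
  have "n x \<le> (1 / a) * (C * 1)"
  proof (rule subadditive_le_sup_norm[where x = x, OF _ _ _ _ F(1) x nx])
    show "n 0 \<le> 0" using D(7)[OF D(2)] by simp
    fix u assume u: "u \<in> vecs ?X"
    show "n u \<le> 1 / a * qnorm ?X u" using ab[OF u] a by (simp add: field_simps)
    fix v assume v: "v \<in> vecs ?X"
    show "n (u + v) \<le> n u + n v" using D(9)[OF u v] by simp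
  qed (use a in auto)
  then have "b * n x \<le> b * (C / a)" using b by (intro mult_left_mono) auto
  moreover have "{i. 1 \<le> norm (x i)} = F" by (auto simp: x_def)
  then have "real (\<phi> F) \<le> qnorm ?X x" using level_le_qnorm[OF xX, of 1] by (simp add: level_def)
  ultimately show False using ab[OF xX] m F(2) by simp
qed

end

section \<open>The Banach envelope of a weak space\<close>

lemma trunc_uniform_approx:
  fixes y :: "nat \<Rightarrow> 'k::real_normed_field"
  assumes "y \<longlonglongrightarrow> 0" "e > 0"
  obtains M where "\<And>N n. N \<ge> M \<Longrightarrow> norm (y n - trunc N y n) \<le> e"
proof -
  obtain M where M: "\<forall>n\<ge>M. norm (y n - 0) < e" using LIMSEQ_D[OF assms] by blast
  have "norm (y n - trunc N y n) \<le> e" if "N \<ge> M" for N n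
    using M that assms(2) by (cases "n < N") (auto simp: trunc_def less_imp_le)
  then show thesis using that by blast
qed

context covered_submeasure
begin

text \<open>The value 0 off the weak space follows the convention for elements of
  \<open>dual\<close>.\<close>

definition coordinate :: "nat \<Rightarrow> (nat \<Rightarrow> 'k::real_normed_field) \<Rightarrow> 'k"
  where "coordinate n x = (if x \<in> vecs (weak_space \<phi>) then x n else 0)"

lemma coordinate_dual:
  shows "coordinate n \<in> vecs (dual (weak_space \<phi> :: ('k::real_normed_field, nat \<Rightarrow> 'k) qspace))"
    and "qnorm (dual (weak_space \<phi> :: ('k, nat \<Rightarrow> 'k) qspace)) (coordinate n) \<le> 1"
proof -
  let ?X = "weak_space \<phi> :: ('k, nat \<Rightarrow> 'k) qspace"
  have b: "norm (coordinate n x) \<le> 1 * qnorm ?X x" if "x \<in> vecs ?X" for x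
    using norm_le_qnorm_weak[OF that] that by (simp add: coordinate_def)
  have "linear_on ?X (*) (coordinate n)"
    unfolding linear_on_def using weakD(3)[where 'k = 'k] weakD(5)[where 'k = 'k]
    by (simp add: coordinate_def) (simp add: smul_weak)
  moreover have "\<exists>K\<ge>0. \<forall>x\<in>vecs ?X. norm (coordinate n x) \<le> K * qnorm ?X x"
    using b by (intro exI[of _ 1]) simp
  ultimately show "coordinate n \<in> vecs (dual ?X)"
    unfolding mem_dual_iff[OF quasi_normed_space_weak] by (simp add: coordinate_def)
  show "qnorm (dual ?X) (coordinate n) \<le> 1"
    by (rule qnorm_dual_le[OF quasi_normed_space_weak _ b]) simp
qed

lemma separating_dual_weak: "separating_dual (weak_space \<phi>)"
  unfolding separating_dual_def
proof (intro ballI impI)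
  fix x :: "nat \<Rightarrow> 'a" assume x: "x \<in> vecs (weak_space \<phi>)" "x \<noteq> 0"
  then obtain n where "x n \<noteq> 0" by (auto simp: fun_eq_iff)
  then have "coordinate n x \<noteq> 0" using x by (simp add: coordinate_def)
  then show "\<exists>f\<in>vecs (dual (weak_space \<phi>)). f x \<noteq> 0" using coordinate_dual(1) by blast
qed

lemma dual_le_sup_norm:
  fixes f :: "(nat \<Rightarrow> 'k::real_normed_field) \<Rightarrow> 'k"
  assumes f: "f \<in> vecs (dual (weak_space \<phi>))"
    and x: "\<And>n. n \<ge> N \<Longrightarrow> x n = 0" and r: "\<And>n. norm (x n) \<le> r"
  shows "norm (f x) \<le> qnorm (dual (weak_space \<phi>)) f * (C * r)"
proof (rule subadditive_le_sup_norm[where F = "{..<N}" and x = x])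
  have lin: "linear_on (weak_space \<phi>) (*) f" using f mem_dual_iff[OF quasi_normed_space_weak] by blast
  show "norm (f 0) \<le> 0"
    using linear_on_diff[OF lin weakD(2) weakD(2)] weakD(2) by simp
  show "norm (f (u + v)) \<le> norm (f u) + norm (f v)"
    if "u \<in> vecs (weak_space \<phi>)" "v \<in> vecs (weak_space \<phi>)" for u v
    using lin that norm_triangle_ineq by (simp add: linear_on_def)
qed (use x r norm_dual_apply_le[OF quasi_normed_space_weak f] in auto)

text \<open>The difference of two truncations is supported below \<open>max N M\<close>, so
  \<open>dual_le_sup_norm\<close> applies. Functionals are thus \<open>C\<close>-Lipschitz for the
  sup norm, up to their own norm.\<close>

lemma dual_trunc_diff_le:
  fixes f :: "(nat \<Rightarrow> 'k::real_normed_field) \<Rightarrow> 'k"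
  assumes f: "f \<in> vecs (dual (weak_space \<phi>))" and r: "\<And>n. norm (trunc N x n - trunc M y n) \<le> r"
  shows "norm (f (trunc N x) - f (trunc M y)) \<le> qnorm (dual (weak_space \<phi>)) f * (C * r)"
proof -
  have lin: "linear_on (weak_space \<phi>) (*) f" using f mem_dual_iff[OF quasi_normed_space_weak] by blast
  have "f (trunc N x) - f (trunc M y) = f (trunc N x - trunc M y)"
    using linear_on_diff[OF lin trunc_mem_weak trunc_mem_weak weakD(4)[OF trunc_mem_weak trunc_mem_weak]] by simp
  also have "norm \<dots> \<le> qnorm (dual (weak_space \<phi>)) f * (C * r)"
    by (rule dual_le_sup_norm[where N = "max N M", OF f]) (use r in \<open>auto simp: trunc_def\<close>)
  finally show ?thesis .
qed

text \<open>By \<open>dual_trunc_diff_le\<close>, functionals on the weak space extend to \<open>c\<^sub>0\<close>; this is the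
  evaluation of the extensions at \<open>y\<close>.\<close>

definition c0_eval :: "(nat \<Rightarrow> 'k::real_normed_field) \<Rightarrow> ((nat \<Rightarrow> 'k) \<Rightarrow> 'k) \<Rightarrow> 'k"
  where "c0_eval y f = (if f \<in> vecs (dual (weak_space \<phi>)) then lim (\<lambda>N. f (trunc N y)) else 0)"

text \<open>Truncations of a null sequence are Cauchy in the sup norm, hence so are their images
  under \<open>f\<close>; completeness of the scalars makes the \<open>lim\<close> in
  \<open>c0_eval\<close> a genuine limit.\<close>

lemma c0_eval_tendsto:
  fixes f :: "(nat \<Rightarrow> 'k::{real_normed_field, banach}) \<Rightarrow> 'k"
  assumes f: "f \<in> vecs (dual (weak_space \<phi>))" and y: "y \<longlonglongrightarrow> 0"
  shows "(\<lambda>N. f (trunc N y)) \<longlonglongrightarrow> c0_eval y f"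
proof -
  let ?q = "qnorm (dual (weak_space \<phi>)) f"
  have q: "0 \<le> ?q" using norm_dual_apply_le(1)[OF quasi_normed_space_weak f] .
  have "Cauchy (\<lambda>N. f (trunc N y))"
  proof (rule CauchyI)
    fix e :: real assume e: "e > 0"
    \<comment> \<open>The summand 1 keeps the divisor \<open>2 * K'\<close> positive when
      \<open>f\<close> has norm 0.\<close>
    define K' where "K' = ?q * C + 1"
    define r where "r = e / (2 * K')"
    have "K' > 0" using q C by (simp add: K'_def add_nonneg_pos)
    then have r: "r > 0" "K' * r = e / 2" using e by (simp_all add: r_def)
    have "norm (trunc N y n - trunc M y n) \<le> r"
      if "\<And>n. n \<ge> K \<Longrightarrow> norm (y n) < r" "N \<ge> K" "M \<ge> K" for K N M n
      using that r(1) by (auto simp: trunc_def intro!: less_imp_le)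
    moreover obtain K where "\<And>n. n \<ge> K \<Longrightarrow> norm (y n) < r" using LIMSEQ_D[OF y r(1)] by auto
    ultimately have K: "norm (trunc N y n - trunc M y n) \<le> r" if "N \<ge> K" "M \<ge> K" for N M n
      using that by blast
    have "norm (f (trunc N y) - f (trunc M y)) < e" if "N \<ge> K" "M \<ge> K" for N M
    proof -
      have "norm (f (trunc N y) - f (trunc M y)) \<le> ?q * (C * r)"
        by (rule dual_trunc_diff_le[OF f K[OF that]])
      also have "\<dots> \<le> K' * r" using r(1) by (simp add: K'_def algebra_simps)
      also have "\<dots> < e" using r e by simp
      finally show ?thesis .
    qed
    then show "\<exists>K. \<forall>N\<ge>K. \<forall>M\<ge>K. norm (f (trunc N y) - f (trunc M y)) < e" by blast
  qed
  then show ?thesis using f by (simp add: c0_eval_def Cauchy_convergent_iff convergent_LIMSEQ_iff)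
qed

text \<open>For such \<open>x\<close> the truncations converge in the quasi-norm itself, and
  boundedness of \<open>f\<close> identifies the limit as \<open>f x\<close>. So
  \<open>c0_eval\<close> extends the bidual embedding.\<close>

lemma c0_eval_weak:
  fixes x :: "nat \<Rightarrow> 'k::{real_normed_field, banach}"
  assumes x: "x \<in> vecs (weak_space \<phi>)"
  shows "c0_eval x = bidual_embedding (weak_space \<phi>) x"
proof
  fix f :: "(nat \<Rightarrow> 'k) \<Rightarrow> 'k"
  show "c0_eval x f = bidual_embedding (weak_space \<phi>) x f"
  proof (cases "f \<in> vecs (dual (weak_space \<phi>))")
    case f: True
    have lin: "linear_on (weak_space \<phi>) (*) f" using f mem_dual_iff[OF quasi_normed_space_weak] by blast
    have "(\<lambda>N. f x - f (trunc N x)) \<longlonglongrightarrow> 0"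
    proof (rule Lim_null_comparison)
      show "\<forall>\<^sub>F N in sequentially. norm (f x - f (trunc N x))
          \<le> qnorm (dual (weak_space \<phi>)) f * qnorm (weak_space \<phi>) (x - trunc N x)"
        using norm_dual_apply_le(2)[OF quasi_normed_space_weak f weakD(4)[OF x trunc_mem_weak]]
          linear_on_diff[OF lin x trunc_mem_weak weakD(4)[OF x trunc_mem_weak]] by simp
      show "(\<lambda>N. qnorm (dual (weak_space \<phi>)) f * qnorm (weak_space \<phi>) (x - trunc N x)) \<longlonglongrightarrow> 0"
        by (rule tendsto_mult_right_zero[OF trunc_converges_weak[OF x]])
    qed
    from tendsto_diff[OF tendsto_const[of "f x"] this] have "(\<lambda>N. f (trunc N x)) \<longlonglongrightarrow> f x" by simp
    with c0_eval_tendsto[OF f weak_space_tendsto[OF x]] have "c0_eval x f = f x" by (rule LIMSEQ_unique)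
    then show ?thesis using f by (simp add: bidual_embedding_def)
  qed (simp add: c0_eval_def bidual_embedding_def)
qed

lemma c0_eval_diff_le:
  fixes f :: "(nat \<Rightarrow> 'k::{real_normed_field, banach}) \<Rightarrow> 'k"
  assumes f: "f \<in> vecs (dual (weak_space \<phi>))" and x: "x \<longlonglongrightarrow> 0" and y: "y \<longlonglongrightarrow> 0"
    and r: "\<And>n. norm (x n - y n) \<le> r"
  shows "norm (c0_eval x f - c0_eval y f) \<le> C * r * qnorm (dual (weak_space \<phi>)) f"
proof (rule LIMSEQ_le_const2)
  show "(\<lambda>N. norm (f (trunc N x) - f (trunc N y))) \<longlonglongrightarrow> norm (c0_eval x f - c0_eval y f)"
    by (intro tendsto_intros c0_eval_tendsto f x y)
  have r0: "0 \<le> r" using r[of 0] norm_ge_zero order_trans by blast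
  have "norm (f (trunc N x) - f (trunc N y)) \<le> qnorm (dual (weak_space \<phi>)) f * (C * r)" for N
    by (rule dual_trunc_diff_le[OF f]) (use r r0 in \<open>simp add: trunc_def\<close>)
  then show "\<exists>M. \<forall>N\<ge>M. norm (f (trunc N x) - f (trunc N y)) \<le> C * r * qnorm (dual (weak_space \<phi>)) f"
    by (simp add: mult.commute)
qed

lemma c0_eval_bidual:
  fixes y :: "nat \<Rightarrow> 'k::{real_normed_field, banach}"
  assumes y: "y \<in> vecs c0"
  shows "c0_eval y \<in> vecs (dual (dual (weak_space \<phi>)))"
    and "qnorm (dual (dual (weak_space \<phi>))) (c0_eval y) \<le> C * qnorm c0 y"
proof -
  let ?X = "weak_space \<phi> :: ('k, nat \<Rightarrow> 'k) qspace"
  have y0: "y \<longlonglongrightarrow> 0" using y by (simp add: c0_def)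
  note N = normed_space_dual[OF quasi_normed_space_weak[where 'a = 'k]]
  note D = quasi_norm_constD[OF N[unfolded normed_space_def]]
  have sm: "smul (dual ?X) = fun_scale" by (simp add: dual_def)
  \<comment> \<open>The norm bound comes from comparing \<open>y\<close> with 0 in
    \<open>c0_eval_diff_le\<close>, for which the evaluation at 0 has to vanish.\<close>
  have z: "c0_eval 0 f = 0" if f: "f \<in> vecs (dual ?X)" for f
  proof -
    have "linear_on ?X (*) f" using f mem_dual_iff[OF quasi_normed_space_weak] by blast
    then have "f 0 = 0" using linear_on_diff[OF _ weakD(2) weakD(2)] weakD(2) by fastforce
    then show ?thesis using c0_eval_weak[OF weakD(2)[where 'k = 'k]] by (simp add: bidual_embedding_def)
  qed
  have b: "norm (c0_eval y f) \<le> (C * qnorm c0 y) * qnorm (dual ?X) f" if f: "f \<in> vecs (dual ?X)" for f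
    using c0_eval_diff_le[OF f y0, of 0] norm_le_c0[OF y] z[OF f] by (simp add: zero_fun_def)
  have "0 \<le> qnorm c0 y" using norm_le_c0[OF y, of 0] norm_ge_zero order_trans by blast
  then have p: "0 \<le> C * qnorm c0 y" using C by simp
  have "linear_on (dual ?X) (*) (c0_eval y)"
    unfolding linear_on_def
  proof (intro conjI ballI allI)
    fix f g assume f: "f \<in> vecs (dual ?X)" and g: "g \<in> vecs (dual ?X)"
    show "c0_eval y (f + g) = c0_eval y f + c0_eval y g"
      using c0_eval_tendsto[OF D(3)[OF f g] y0] tendsto_add[OF c0_eval_tendsto[OF f y0] c0_eval_tendsto[OF g y0]]
      by (simp add: LIMSEQ_unique)
  next
    fix c f assume f: "f \<in> vecs (dual ?X)"
    show "c0_eval y (smul (dual ?X) c f) = c * c0_eval y f"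
      using c0_eval_tendsto[OF D(5)[OF f, of c] y0] tendsto_mult[OF tendsto_const c0_eval_tendsto[OF f y0], of c]
      unfolding sm by (rule LIMSEQ_unique)
  qed
  moreover have "\<exists>K\<ge>0. \<forall>f\<in>vecs (dual ?X). norm (c0_eval y f) \<le> K * qnorm (dual ?X) f"
    using b p by blast
  moreover have "\<forall>f. f \<notin> vecs (dual ?X) \<longrightarrow> c0_eval y f = 0" by (simp add: c0_eval_def)
  ultimately show "c0_eval y \<in> vecs (dual (dual ?X))"
    unfolding mem_dual_iff[OF quasi_normed_space_if_normed[OF N]] by blast
  show "qnorm (dual (dual ?X)) (c0_eval y) \<le> C * qnorm c0 y"
    by (rule qnorm_dual_le[OF quasi_normed_space_if_normed[OF N] p b])
qed

text \<open>Truncations of \<open>y\<close> lie in the weak space and approximate \<open>y\<close>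
  uniformly, so their embeddings approximate \<open>c0_eval y\<close> in the bidual norm.\<close>

lemma c0_eval_envelope:
  fixes y :: "nat \<Rightarrow> 'k::{real_normed_field, banach}"
  assumes y: "y \<in> vecs c0"
  shows "c0_eval y \<in> vecs (banach_envelope (weak_space \<phi>))"
  unfolding mem_banach_envelope_iff[OF quasi_normed_space_weak]
proof (intro conjI allI impI c0_eval_bidual(1)[OF y])
  have y0: "y \<longlonglongrightarrow> 0" using y by (simp add: c0_def)
  fix e :: real assume e: "e > 0"
  then have e': "e / (2 * C) > 0" using C by simp
  obtain N where N: "\<And>n. norm (y n - trunc N y n) \<le> e / (2 * C)"
    using trunc_uniform_approx[OF y0 e'] by (metis order_refl)
  note t = trunc_mem_weak[of N y]
  have "qnorm (dual (dual (weak_space \<phi>))) (bidual_embedding (weak_space \<phi>) (trunc N y) - c0_eval y)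
    \<le> C * (e / (2 * C))"
  proof (rule bidual_embedding_diff_bound[OF _ quasi_normed_space_weak])
    fix f :: "(nat \<Rightarrow> 'k) \<Rightarrow> 'k" assume f: "f \<in> vecs (dual (weak_space \<phi>))"
    have eq: "f (trunc N y) = c0_eval (trunc N y) f"
      using c0_eval_weak[OF t] f by (simp add: bidual_embedding_def)
    show "norm (f (trunc N y) - c0_eval y f) \<le> C * (e / (2 * C)) * qnorm (dual (weak_space \<phi>)) f"
      unfolding eq
      by (rule c0_eval_diff_le[OF f weak_space_tendsto[OF t] y0]) (subst norm_minus_commute, rule N)
  qed (use C e in simp)
  also have "\<dots> < e" using C e by simp
  finally show "\<exists>x\<in>vecs (weak_space \<phi>).
      qnorm (dual (dual (weak_space \<phi>))) (bidual_embedding (weak_space \<phi>) x - c0_eval y) < e"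
    using t by blast
qed

text \<open>The isomorphism \<open>T\<close> evaluates a bidual element at the coordinate
  functionals, whose norms are at most 1; its inverse is \<open>c0_eval\<close>, of norm at most
  \<open>C\<close>.\<close>

theorem banach_envelope_weak_isomorphic_c0:
  "isomorphic_const C (banach_envelope (weak_space \<phi> :: ('k::{real_normed_field, banach}, nat \<Rightarrow> 'k) qspace))
    (c0 :: ('k, nat \<Rightarrow> 'k) qspace)"
proof -
  let ?X = "weak_space \<phi> :: ('k, nat \<Rightarrow> 'k) qspace"
  let ?D = "dual (dual ?X)" and ?E = "banach_envelope ?X"
  define T where "T \<Phi> = (\<lambda>n. \<Phi> (coordinate n) :: 'k)" for \<Phi> :: "((nat \<Rightarrow> 'k) \<Rightarrow> 'k) \<Rightarrow> 'k"
  note qX = quasi_normed_space_weak[where 'a = 'k]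
  note qX' = quasi_normed_space_if_normed[OF normed_space_dual[OF qX]]
  note qX'' = quasi_normed_space_if_normed[OF normed_space_dual[OF qX']]
  note DD = quasi_norm_constD[OF normed_space_dual[OF qX', unfolded normed_space_def]]
  have approx: "\<Phi> \<in> vecs ?D \<and> (\<forall>e>0. \<exists>x\<in>vecs ?X. qnorm ?D (bidual_embedding ?X x - \<Phi>) < e)"
    if "\<Phi> \<in> vecs ?E" for \<Phi>
    using that mem_banach_envelope_iff[OF qX] by blast
  have close: "norm (f x - \<Phi> f) \<le> qnorm ?D (bidual_embedding ?X x - \<Phi>) * qnorm (dual ?X) f"
    if "\<Phi> \<in> vecs ?D" "x \<in> vecs ?X" "f \<in> vecs (dual ?X)" for \<Phi> x f
    using norm_dual_apply_le(2)[OF qX' DD(4)[OF bidual_embedding_mem[OF qX that(2)] that(1)] that(3)] that(3)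
    by (simp add: bidual_embedding_def)
  have T_close: "norm (x n - T \<Phi> n) \<le> qnorm ?D (bidual_embedding ?X x - \<Phi>)"
    if "\<Phi> \<in> vecs ?D" "x \<in> vecs ?X" for \<Phi> x n
  proof -
    have "norm (x n - T \<Phi> n) \<le> qnorm ?D (bidual_embedding ?X x - \<Phi>) * qnorm (dual ?X) (coordinate n)"
      using close[OF that coordinate_dual(1), of n] that by (simp add: T_def coordinate_def)
    also have "\<dots> \<le> qnorm ?D (bidual_embedding ?X x - \<Phi>) * 1"
      using DD(6)[OF DD(4)[OF bidual_embedding_mem[OF qX that(2)] that(1)]] coordinate_dual(2)
      by (intro mult_left_mono)
    finally show ?thesis by simp
  qed
  have T0: "T \<Phi> \<longlonglongrightarrow> 0" if \<Phi>: "\<Phi> \<in> vecs ?E" for \<Phi>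
  proof (rule LIMSEQ_I)
    fix e :: real assume "e > 0"
    then have e: "e / 2 > 0" by simp
    then obtain x where x: "x \<in> vecs ?X" "qnorm ?D (bidual_embedding ?X x - \<Phi>) < e / 2"
      using approx[OF \<Phi>] by blast
    obtain M where M: "\<forall>n\<ge>M. norm (x n - 0) < e / 2"
      using LIMSEQ_D[OF weak_space_tendsto[OF x(1)] e] by blast
    have "norm (T \<Phi> n - 0) < e" if "n \<ge> M" for n
      using T_close[OF conjunct1[OF approx[OF \<Phi>]] x(1), of n] x(2) M[rule_format, OF that]
        norm_triangle_ineq3[of "x n" "T \<Phi> n"] by simp
    then show "\<exists>M. \<forall>n\<ge>M. norm (T \<Phi> n - 0) < e" by blast
  qed
  \<comment> \<open>Both sides are compared with an approximant \<open>x\<close> from the weak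
    space, where \<open>c0_eval x f = f x\<close>; the errors add up to
    \<open>(C + 1) * ?q * d\<close>.\<close>
  have RT: "c0_eval (T \<Phi>) = \<Phi>" if \<Phi>: "\<Phi> \<in> vecs ?E" for \<Phi>
  proof
    fix f :: "(nat \<Rightarrow> 'k) \<Rightarrow> 'k"
    show "c0_eval (T \<Phi>) f = \<Phi> f"
    proof (cases "f \<in> vecs (dual ?X)")
      case f: True
      let ?q = "qnorm (dual ?X) f"
      have q: "0 \<le> ?q" by (rule norm_dual_apply_le(1)[OF qX f])
      have p: "(C + 1) * ?q + 1 > 0" using q C by (intro add_nonneg_pos) auto
      have "norm (c0_eval (T \<Phi>) f - \<Phi> f) \<le> 0 + e" if e: "e > 0" for e
      proof -
        define d where "d = e / ((C + 1) * ?q + 1)"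
        have d: "d > 0" "((C + 1) * ?q + 1) * d = e" using e p by (simp_all add: d_def)
        obtain x where x: "x \<in> vecs ?X" "qnorm ?D (bidual_embedding ?X x - \<Phi>) < d"
          using approx[OF \<Phi>] d(1) by blast
        have "norm (T \<Phi> n - x n) \<le> d" for n
          using T_close[OF conjunct1[OF approx[OF \<Phi>]] x(1), of n] x(2) by (simp add: norm_minus_commute)
        then have "norm (c0_eval (T \<Phi>) f - c0_eval x f) \<le> C * d * ?q"
          by (rule c0_eval_diff_le[OF f T0[OF \<Phi>] weak_space_tendsto[OF x(1)]])
        moreover have "c0_eval x f = f x" using f c0_eval_weak[OF x(1)] by (simp add: bidual_embedding_def)
        moreover have "norm (f x - \<Phi> f) \<le> d * ?q"
          using close[OF conjunct1[OF approx[OF \<Phi>]] x(1) f] mult_right_mono[OF less_imp_le[OF x(2)] q] by simp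
        ultimately have "norm (c0_eval (T \<Phi>) f - \<Phi> f) \<le> C * d * ?q + d * ?q"
          using norm_triangle_ineq[of "c0_eval (T \<Phi>) f - f x" "f x - \<Phi> f"] by simp
        also have "\<dots> \<le> ((C + 1) * ?q + 1) * d" using d(1) by (simp add: algebra_simps)
        finally show ?thesis using d(2) by simp
      qed
      then have "norm (c0_eval (T \<Phi>) f - \<Phi> f) \<le> 0" by (rule field_le_epsilon)
      then show ?thesis by simp
    next
      case False
      have "\<Phi> \<in> vecs ?D" using approx[OF \<Phi>] by blast
      then have "\<Phi> f = 0" using False unfolding mem_dual_iff[OF qX'] by blast
      then show ?thesis using False by (simp add: c0_eval_def)
    qed
  qed
  have TR: "T (c0_eval y) = y" if y: "y \<in> vecs c0" for y
  proof
    fix n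
    have "(\<lambda>N. coordinate n (trunc N y)) \<longlonglongrightarrow> T (c0_eval y) n"
      unfolding T_def using y by (intro c0_eval_tendsto coordinate_dual(1)) (simp add: c0_def)
    moreover have "(\<lambda>N. coordinate n (trunc N y)) \<longlonglongrightarrow> y n"
    \<comment> \<open>Truncation at any \<open>N > n\<close> leaves coordinate \<open>n\<close>
      unchanged.\<close>
    proof (rule tendsto_eventually)
      show "\<forall>\<^sub>F N in sequentially. coordinate n (trunc N y) = y n"
        using eventually_gt_at_top[of n]
        by eventually_elim (simp add: coordinate_def trunc_mem_weak, simp add: trunc_def)
    qed
    ultimately show "T (c0_eval y) n = y n" by (rule LIMSEQ_unique)
  qed
  have "isomorphic_const (1 * C) ?E (c0 :: ('k, nat \<Rightarrow> 'k) qspace)"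
  proof (rule isomorphic_constI[where T = T and R = c0_eval])
    show "quasi_normed_space ?E" by (intro quasi_normed_space_if_normed normed_space_banach_envelope qX)
    show "quasi_normed_space (c0 :: ('k, nat \<Rightarrow> 'k) qspace)"
      by (intro quasi_normed_space_if_normed normed_space_c0)
    show "linear_on ?E (smul c0) T" by (simp add: linear_on_def T_def c0_def fun_eq_iff)
    show "T \<Phi> \<in> vecs c0" if "\<Phi> \<in> vecs ?E" for \<Phi> using T0[OF that] by (simp add: c0_def)
    show "qnorm c0 (T \<Phi>) \<le> 1 * qnorm ?E \<Phi>" if \<Phi>: "\<Phi> \<in> vecs ?E" for \<Phi>
    proof (rule c0_norm_le)
      fix n
      have \<Phi>D: "\<Phi> \<in> vecs ?D" using approx[OF \<Phi>] by blast
      have "norm (T \<Phi> n) \<le> qnorm ?D \<Phi> * qnorm (dual ?X) (coordinate n)"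
        unfolding T_def by (rule norm_dual_apply_le(2)[OF qX' \<Phi>D coordinate_dual(1)])
      also have "\<dots> \<le> qnorm ?D \<Phi> * 1"
        using DD(6)[OF \<Phi>D] coordinate_dual(2) by (intro mult_left_mono)
      finally show "norm (T \<Phi> n) \<le> 1 * qnorm ?E \<Phi>" by simp
    qed
  qed (use C RT TR c0_eval_envelope c0_eval_bidual(2) in auto)
  then show ?thesis by simp
qed

end

section \<open>A submeasure from periodic sets\<close>

text \<open>For \<open>C > 0\<close> the inequality says that the density \<open>card D / p\<close>
  is at most \<open>1 - 1 / C\<close>. The natural-number subtraction is exact because
  \<open>D\<close> lies below \<open>p\<close>.\<close>

definition periodic_sets :: "real \<Rightarrow> nat set set"
  where "periodic_sets C = {{i. i mod p \<in> D} | p D. 0 < p \<and> D \<subseteq> {..<p} \<and> real p \<le> C * real (p - card D)}"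

text \<open>Each further block of \<open>p\<close> consecutive numbers contributes one translate of
  \<open>D\<close>.\<close>

lemma card_mod_mem:
  fixes p k :: nat
  assumes "D \<subseteq> {..<p}"
  shows "card {i. i < k * p \<and> i mod p \<in> D} = k * card D"
proof (induction k)
  case (Suc k)
  have *: "{i. i < Suc k * p \<and> i mod p \<in> D} = {i. i < k * p \<and> i mod p \<in> D} \<union> (\<lambda>d. k * p + d) ` D"
  proof (intro equalityI subsetI)
    fix i assume i: "i \<in> {i. i < Suc k * p \<and> i mod p \<in> D}"
    show "i \<in> {i. i < k * p \<and> i mod p \<in> D} \<union> (\<lambda>d. k * p + d) ` D"
    proof (cases "i < k * p")
      case False
      then have "i - k * p < p" "i = k * p + (i - k * p)" using i by auto
      then have "i mod p = i - k * p" by (metis mod_less mod_mult_self3)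
      then show ?thesis using i \<open>i = k * p + (i - k * p)\<close> by auto
    qed (use i in auto)
  qed (use assms in auto)
  have fin: "finite D" using assms finite_subset by blast
  have "card {i. i < Suc k * p \<and> i mod p \<in> D}
    = card {i. i < k * p \<and> i mod p \<in> D} + card ((\<lambda>d. k * p + d) ` D)"
    unfolding * using fin by (intro card_Un_disjoint) auto
  also have "card ((\<lambda>d. k * p + d) ` D) = card D" by (intro card_image) (simp add: inj_on_def)
  finally show ?case using Suc by simp
qed simp

lemma periodic_sets_density:
  assumes "finite \<W>" "\<W> \<subseteq> periodic_sets C"
  obtains P :: nat where "P > 0" "\<And>W. W \<in> \<W> \<Longrightarrow> real P \<le> C * real (card {i. i < P \<and> i \<notin> W})"
proof -
  have "\<exists>p>0. \<exists>D\<subseteq>{..<p}. real p \<le> C * real (p - card D) \<and> W = {i. i mod p \<in> D}" if "W \<in> \<W>" for W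
    using that assms(2) unfolding periodic_sets_def by blast
  then obtain p D where p: "\<And>W. W \<in> \<W> \<Longrightarrow> 0 < p W \<and> D W \<subseteq> {..<p W} \<and>
      real (p W) \<le> C * real (p W - card (D W)) \<and> W = {i. i mod p W \<in> D W}"
    by metis
  \<comment> \<open>The product of the periods is a common period, over which each set repeats a
    whole number of times.\<close>
  define P where "P = (\<Prod>W\<in>\<W>. p W)"
  show thesis
  proof (rule that[of P])
    show "P > 0" using p by (simp add: P_def prod_pos)
    fix W assume W: "W \<in> \<W>"
    then have "p W dvd P" unfolding P_def using assms(1) by (simp add: dvd_prodI)
    then obtain k where k: "P = k * p W" by (metis dvdE mult.commute)
    have fin: "finite (D W)" using p[OF W] finite_subset by blast
    have "i \<notin> W \<longleftrightarrow> i mod p W \<in> {..<p W} - D W" for i using p[OF W] by auto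
    then have "card {i. i < P \<and> i \<notin> W} = card {i. i < k * p W \<and> i mod p W \<in> {..<p W} - D W}"
      by (simp add: k)
    also have "\<dots> = k * (p W - card (D W))"
      using p[OF W] fin by (subst card_mod_mem) (auto simp: card_Diff_subset)
    finally have card: "card {i. i < P \<and> i \<notin> W} = k * (p W - card (D W))" .
    have "real P = real k * real (p W)" by (simp add: k)
    also have "\<dots> \<le> real k * (C * real (p W - card (D W)))"
      using p[OF W] by (intro mult_left_mono) auto
    also have "\<dots> = C * real (card {i. i < P \<and> i \<notin> W})" by (simp add: card)
    finally show "real P \<le> C * real (card {i. i < P \<and> i \<notin> W})" .
  qed
qed

text \<open>At most \<open>m\<close> points have at most \<open>m\<close> residues, a small
  proportion of a large period. The family is fixed by \<open>m\<close> before \<open>I\<close> is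
  given, which yields unboundedness on a finite set.\<close>

lemma periodic_sets_cover:
  fixes m :: nat
  assumes "C > 1"
  obtains \<W> where "finite \<W>" "\<W> \<subseteq> periodic_sets C"
    "\<And>I. finite I \<Longrightarrow> card I \<le> m \<Longrightarrow> \<exists>W\<in>\<W>. I \<subseteq> W"
proof -
  \<comment> \<open>The choice makes \<open>real p * (C - 1)\<close> exceed
    \<open>C * real m\<close>, so that \<open>m\<close> residues satisfy the density condition
    modulo \<open>p\<close>.\<close>
  obtain p :: nat where p: "C * real m / (C - 1) + 1 < real p" using reals_Archimedean2 by blast
  have "0 \<le> C * real m / (C - 1)" using assms by simp
  then have p0: "0 < p" using p by linarith
  have "C * real m < real p * (C - 1)" using p assms by (simp add: field_simps)
  then have pC: "real p \<le> C * (real p - real m)" by (simp add: algebra_simps)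
  let ?\<W> = "(\<lambda>D. {i. i mod p \<in> D}) ` {D. D \<subseteq> {..<p} \<and> card D \<le> m}"
  show thesis
  proof (rule that[of ?\<W>])
    show "finite ?\<W>" by simp
    show "?\<W> \<subseteq> periodic_sets C"
    proof (clarify)
      fix D assume D: "D \<subseteq> {..<p}" "card D \<le> m"
      have "card D \<le> p" using card_mono[OF _ D(1)] by simp
      then have "C * (real p - real m) \<le> C * real (p - card D)"
        using D(2) assms by (intro mult_left_mono) auto
      with pC have "real p \<le> C * real (p - card D)" by (rule order_trans)
      then show "{i. i mod p \<in> D} \<in> periodic_sets C"
        unfolding periodic_sets_def using D(1) p0 by blast
    qed
    fix I :: "nat set" assume I: "finite I" "card I \<le> m"
    let ?D = "(\<lambda>i. i mod p) ` I"
    have "?D \<in> {D. D \<subseteq> {..<p} \<and> card D \<le> m}"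
      using p0 I card_image_le[OF I(1), of "\<lambda>i. i mod p"] by auto
    moreover have "I \<subseteq> {i. i mod p \<in> ?D}" by blast
    ultimately show "\<exists>W\<in>?\<W>. I \<subseteq> W" by blast
  qed
qed

lemma countable_periodic_sets: "countable (periodic_sets C)"
proof (rule countable_subset)
  show "periodic_sets C \<subseteq> (\<lambda>(p, D). {i. i mod p \<in> D}) ` (UNIV \<times> {D. finite D})"
  proof
    fix W assume "W \<in> periodic_sets C"
    then obtain p D where "W = {i. i mod p \<in> D}" "D \<subseteq> {..<p}" unfolding periodic_sets_def by blast
    then have "W = (\<lambda>(p, D). {i. i mod p \<in> D}) (p, D)" "(p, D) \<in> UNIV \<times> {D. finite D}"
      using finite_subset by auto
    then show "W \<in> (\<lambda>(p, D). {i. i mod p \<in> D}) ` (UNIV \<times> {D. finite D})" by blast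
  qed
  show "countable ((\<lambda>(p, D). {i. i mod p \<in> D}) ` (UNIV \<times> {D :: nat set. finite D}))"
    by (intro countable_image countable_SIGMA countable_Collect_finite) auto
qed

text \<open>
  Equivalently, the least number of sets of the form \<open>{n. i \<notin> W n}\<close> that cover \<open>A\<close>; the value is
  meaningless if there is no such cover.
\<close>

definition hitting_number :: "(nat \<Rightarrow> nat set) \<Rightarrow> nat set \<Rightarrow> nat"
  where "hitting_number W A = (LEAST m. \<exists>I. finite I \<and> card I = m \<and> (\<forall>n\<in>A. \<not> I \<subseteq> W n))"

section \<open>Hitting numbers as a covered submeasure\<close>

lemma hitting_number_le:
  assumes "finite I" "\<And>n. n \<in> A \<Longrightarrow> \<not> I \<subseteq> W n"
  shows "hitting_number W A \<le> card I"
  unfolding hitting_number_def using assms by (intro Least_le) auto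

text \<open>A point outside each \<open>W n\<close> with \<open>n\<close> in \<open>A\<close> gives
  some finite hitting set, so the \<open>LEAST\<close> is attained.\<close>

lemma hitting_number_witness:
  assumes "finite A" "\<And>n. W n \<noteq> UNIV"
  obtains I where "finite I" "card I = hitting_number W A" "\<And>n. n \<in> A \<Longrightarrow> \<not> I \<subseteq> W n"
proof -
  have "\<exists>i. i \<notin> W n" for n using assms(2)[of n] by blast
  then obtain w where w: "\<And>n. w n \<notin> W n" by metis
  have "\<exists>I. finite I \<and> card I = card (w ` A) \<and> (\<forall>n\<in>A. \<not> I \<subseteq> W n)"
    using assms(1) w by (intro exI[of _ "w ` A"]) auto
  then have "\<exists>I. finite I \<and> card I = hitting_number W A \<and> (\<forall>n\<in>A. \<not> I \<subseteq> W n)"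
    unfolding hitting_number_def by (rule LeastI)
  then show thesis using that by blast
qed

lemma covered_submeasure_exists:
  assumes "C > 1"
  obtains \<phi> where "covered_submeasure \<phi> C"
proof -
  \<comment> \<open>A nonempty countable family is the range of a sequence, possibly with
    repetitions. Covering the empty set shows that it is nonempty.\<close>
  have "periodic_sets C \<noteq> {}"
    using periodic_sets_cover[OF assms, of 0] by (metis card.empty empty_iff finite.emptyI subset_empty le0)
  then obtain W :: "nat \<Rightarrow> nat set" where W: "range W = periodic_sets C"
    using countable_periodic_sets uncountable_def by metis
  have density: "\<exists>P::nat. P > 0 \<and> (\<forall>n\<in>F. real P \<le> C * real (card {i. i < P \<and> i \<notin> W n}))" if "finite F" for F
  proof -
    have "finite (W ` F)" "W ` F \<subseteq> periodic_sets C" using that W by auto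
    then obtain P :: nat where "P > 0" "\<And>V. V \<in> W ` F \<Longrightarrow> real P \<le> C * real (card {i. i < P \<and> i \<notin> V})"
      by (rule periodic_sets_density) blast
    then show ?thesis by blast
  qed
  have W_proper: "W n \<noteq> UNIV" for n
  proof
    assume "W n = UNIV"
    \<comment> \<open>For \<open>W n = UNIV\<close> no \<open>i\<close> lies outside, so the
      positive \<open>P\<close> would be at most 0.\<close>
    then show False using density[of "{n}"] by auto
  qed
  note witness = hitting_number_witness[where W = W, OF _ W_proper]
  have "covered_submeasure (hitting_number W) C"
  proof
    show "C \<ge> 1" using assms by simp
    show "hitting_number W {} = 0" using hitting_number_le[of "{}" "{}" W] by simp
    show "hitting_number W A \<le> hitting_number W B" if AB: "finite B" "A \<subseteq> B" for A B
    proof -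
      obtain I where "finite I" "card I = hitting_number W B" "\<And>n. n \<in> B \<Longrightarrow> \<not> I \<subseteq> W n"
        by (rule witness[OF AB(1)]) blast
      then show ?thesis using hitting_number_le[of I A W] AB(2) by auto
    qed
    show "hitting_number W (A \<union> B) \<le> hitting_number W A + hitting_number W B"
      if AB: "finite A" "finite B" for A B
    proof -
      obtain I where I: "finite I" "card I = hitting_number W A" "\<And>n. n \<in> A \<Longrightarrow> \<not> I \<subseteq> W n"
        by (rule witness[OF AB(1)]) blast
      obtain J where J: "finite J" "card J = hitting_number W B" "\<And>n. n \<in> B \<Longrightarrow> \<not> J \<subseteq> W n"
        by (rule witness[OF AB(2)]) blast
      have "hitting_number W (A \<union> B) \<le> card (I \<union> J)"
        using I J by (intro hitting_number_le) auto
      also have "\<dots> \<le> card I + card J" by (rule card_Un_le)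
      finally show ?thesis using I(2) J(2) by simp
    qed
    show "1 \<le> hitting_number W A" if A: "finite A" "A \<noteq> {}" for A
    proof -
      obtain I where I: "finite I" "card I = hitting_number W A" "\<And>n. n \<in> A \<Longrightarrow> \<not> I \<subseteq> W n"
        by (rule witness[OF A(1)]) blast
      then have "I \<noteq> {}" using A(2) by auto
      then have "card I > 0" using I(1) by (simp add: card_gt_0_iff)
      then show ?thesis using I(2) by simp
    qed
    show "\<exists>P::nat. \<exists>B. 0 < P \<and> (\<forall>i<P. B i \<subseteq> F \<and> hitting_number W (B i) \<le> 1) \<and>
        (\<forall>n\<in>F. real P \<le> C * real (card {i. i < P \<and> n \<in> B i}))" if F: "finite F" for F
    proof -
      obtain P :: nat where P: "P > 0" "\<forall>n\<in>F. real P \<le> C * real (card {i. i < P \<and> i \<notin> W n})"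
        using density[OF F] by blast
      \<comment> \<open>The single point \<open>i\<close> hits all of \<open>?B i\<close>, and the
        indices \<open>i < P\<close> with \<open>n\<close> in \<open>?B i\<close> are those counted
        by \<open>density\<close>.\<close>
      let ?B = "\<lambda>i. {n \<in> F. i \<notin> W n}"
      have "hitting_number W (?B i) \<le> 1" for i
        using hitting_number_le[of "{i}" "?B i" W] by simp
      then show ?thesis using P by (intro exI[of _ P] exI[of _ ?B]) auto
    qed
    show "\<exists>F. finite F \<and> m < hitting_number W F" for m
    proof -
      obtain \<W> where \<W>: "finite \<W>" "\<W> \<subseteq> periodic_sets C"
        "\<And>I. finite I \<Longrightarrow> card I \<le> m \<Longrightarrow> \<exists>V\<in>\<W>. I \<subseteq> V"
        using periodic_sets_cover[OF assms, of m] by blast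
      \<comment> \<open>\<open>F\<close> indexes the covering family. A set of at most
        \<open>m\<close> points lies in some \<open>W n\<close> with \<open>n\<close> in
        \<open>F\<close>, so it cannot hit all of \<open>F\<close>.\<close>
      then obtain F where F: "finite F" "\<W> = W ` F"
        using finite_subset_image[OF \<W>(1), of W UNIV] W by auto
      obtain I where "finite I" "card I = hitting_number W F" "\<And>n. n \<in> F \<Longrightarrow> \<not> I \<subseteq> W n"
        by (rule witness[OF F(1)]) blast
      then have "m < hitting_number W F" using \<W>(3)[of I] F(2) by force
      then show ?thesis using F(1) by blast
    qed
  qed
  then show thesis by (rule that)
qed

theorem proposition8:
  fixes \<epsilon> :: real
  assumes "\<epsilon> > 0"
  shows "(\<exists>X :: (real, nat \<Rightarrow> real) qspace.
            quasi_banach_space X \<and> \<not> locally_convex X \<and> separating_dual X \<and>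
            isomorphic_const (1 + \<epsilon>) (banach_envelope X) (c0 :: (real, nat \<Rightarrow> real) qspace)) \<and>
         (\<exists>X :: (complex, nat \<Rightarrow> complex) qspace.
            quasi_banach_space X \<and> \<not> locally_convex X \<and> separating_dual X \<and>
            isomorphic_const (1 + \<epsilon>) (banach_envelope X) (c0 :: (complex, nat \<Rightarrow> complex) qspace))"
proof -
  \<comment> \<open>The submeasure does not involve the scalars, so one \<open>\<phi>\<close> serves
    both the real and the complex case.\<close>
  obtain \<phi> where "covered_submeasure \<phi> (1 + \<epsilon>)"
    using covered_submeasure_exists[of "1 + \<epsilon>"] assms by auto
  then interpret covered_submeasure \<phi> "1 + \<epsilon>" .
  show ?thesis
    by (intro conjI exI[of _ "weak_space \<phi>"] quasi_banach_space_weak not_locally_convex_weak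
        separating_dual_weak banach_envelope_weak_isomorphic_c0)
qed

end
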